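(* Let $n\in\{2,3\}$ and let a level-set field be given by its values $\phi^0$ at the vertices of a uniform Cartesian mesh (level $0$) of a domain $\Omega\subset\mathbb{R}^n$. For $\ell\ge 0$ let the level-$(\ell+1)$ mesh be obtained by dividing each level-$\ell$ cell into $2^n$ equal subcells. Suppose that all cut cells are resolved, and let $\alpha^\ell$ be the volume fraction computed on level $\ell$ by the analytical volume-estimation formulation described in the context. If the level-set field is refined by bilinear ($n=2$) or trilinear ($n=3$) interpolation, that is, the vertex values $\phi^{\ell+1}$ are obtained from $\phi^\ell$ by bilinear/trilinear interpolation in each level-$\ell$ cell, then the analytical volume-estimation formulation is consistent during mesh refinement: $$\int_\Omega \alpha^0\,dV=\int_\Omega\alpha^\ell\,dV ,$$ i.e. the volumes calculated from the initial field and from the refined field are exactly the same.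
   Context: **Interface in a cell.** Each cell is rescaled to $[0,1]^n$ with local coordinates $x,y$ (and $z$). The interface is the zero set of the bilinear/trilinear interpolant of the vertex values. For $n=2$, $\phi(x,y)=\beta_0+\beta_1x+\beta_2y+\beta_3xy$ with $\beta_0=\phi_{00}$, $\beta_1=\phi_{10}-\phi_{00}$, $\beta_2=\phi_{01}-\phi_{00}$, $\beta_3=\phi_{00}+\phi_{11}-\phi_{01}-\phi_{10}$, where $\phi_{pq}$ is the value at vertex $(p,q)$. For $n=3$, $\phi(x,y,z)=\beta_0+\beta_1x+\beta_2y+\beta_3z+\beta_4xy+\beta_5yz+\beta_6xz+\beta_7xyz$, the unique function of this form taking the values $\phi_{pqr}$ at the vertices $(p,q,r)\in\{0,1\}^3$. **Origin and local coordinates of a cut cell.** A cell is cut if its vertex values include both signs. The origin is a vertex $(i_x,i_y)$ or $(i_x,i_y,i_z)$, with entries in $\{0,1\}$, that has the largest number of neighbours (vertices joined to it by an edge) where $\phi$ has the opposite sign. For each coordinate direction $\gamma$, consider the edge from the origin in direction $\gamma$. If $\phi$ has opposite signs at its two ends, let $m_\gamma$ be the $\gamma$-coordinate of the zero of $\phi$ on that edge; otherwise let $m_\gamma=1-i_\gamma$. Put $l_\gamma=|m_\gamma-i_\gamma|$, the distance from the origin. **Formula for $n=2$.** Let $\eta\in\{x,y\}$ be the direction with the larger $l_\gamma$ and $\zeta$ the other one. Writing the interpolant as $a\eta+b+\zeta(c\eta+d)$, the interface is $\zeta(\eta)=-\dfrac{a\eta+b}{c\eta+d}$. With $\eta_0=\min(m_\eta,i_\eta)$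 and $\eta_1=\max(m_\eta,i_\eta)$, the cut volume is the integral $$\alpha=(1-2i_\zeta)\int_{\eta_0}^{\eta_1}\zeta(\eta)\,d\eta+i_\zeta(\eta_1-\eta_0),$$ that is, for $c\neq0$, $$\alpha=(1-2i_\zeta)\left[\frac{(ad-bc)\log|c\eta+d|}{c^2}-\frac{a\eta}{c}\right]_{\eta_0}^{\eta_1}+i_\zeta(\eta_1-\eta_0).$$ **Formula for $n=3$.** Let $\xi$ be the direction with the largest $l_\gamma$, $\eta$ the direction with the larger $l_\gamma$ among the remaining two, and $\zeta$ the last one. Writing the interpolant as $\xi(a\eta+b)+c\eta+d+\zeta\,[\xi(e\eta+f)+g\eta+h]$, the interface is $$\zeta(\xi,\eta)=\frac{-\xi(a\eta+b)-c\eta-d}{\xi(e\eta+f)+g\eta+h}.$$ Put $$q(\xi)=-\frac{(f i_\zeta+b)\xi+h i_\zeta+d}{(e i_\zeta+a)\xi+g i_\zeta+c},$$ $\xi_0=\min(m_\xi,i_\xi)$, $\xi_1=\max(m_\xi,i_\xi)$, and $(\eta_0,\eta_1)=(0,q(\xi))$ if $i_\eta=0$, $(\eta_0,\eta_1)=(q(\xi),1)$ if $i_\eta=1$. For an elementary cell, the cut volume is $$\alpha=(1-2i_\zeta)\int_{\xi_0}^{\xi_1}\left[\int_{\eta_0}^{\eta_1}\zeta(\xi,\eta)\,d\eta\right]d\xi+i_\zeta\int_{\xi_0}^{\xi_1}(\eta_1-\eta_0)\,d\xi ,$$ evaluated exactly in closed form with logarithms and dilogarithms. Other resolved cells are split into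 elementary parts, for instance at the interface intersection points on edges parallel to the $\xi$-direction; the formula is applied to each part and the volumes are combined. **Resolved cells.** The formulation applies only to resolved cut cells: those in which the interface is unambiguous (for example, no multiple intersections with one cell edge), so that the formula gives the volume of the part of the cell on the origin's side of the interface (for $n=3$, directly if the cell is elementary, or part by part after the splitting). **Volume fraction field.** $\alpha^\ell$ is constant on each level-$\ell$ cell and refers to one fixed phase, $\phi>0$. In a cut cell it is the cut volume $\alpha$ above if $\phi>0$ at the origin, and $1-\alpha$ if $\phi<0$ at the origin. In an uncut cell it is $1$ if the cell lies in the positive phase and $0$ if it lies in the negative phase. $dV$ is the volume element. *)

theory Defs
  imports "HOL-Analysis.Analysis"
begin

text \<open>
  The coordinate directions are the elements of a finite type \<open>'n\<close>, so that the space is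
  \<open>real ^ 'n\<close> and \<open>n = CARD('n)\<close>. A vertex of the unit cell is the set \<open>v :: 'n set\<close> of those
  directions in which its coordinate is 1 (all other coordinates are 0), and the vertex
  values of a cell are a function \<open>u :: 'n set \<Rightarrow> real\<close>.
\<close>

section \<open>Multilinear interpolation in a cell\<close>

definition vcoord :: "'n set \<Rightarrow> 'n \<Rightarrow> real" where
  "vcoord v \<gamma> = of_bool (\<gamma> \<in> v)"

text \<open>
  Coefficient of the monomial \<open>\<Prod>\<gamma>\<in>S. x\<^sub>\<gamma>\<close>. For two directions \<open>x\<close>, \<open>y\<close> this gives
  \<open>coef u {} = \<phi>\<^sub>0\<^sub>0\<close>, \<open>coef u {x} = \<phi>\<^sub>1\<^sub>0 - \<phi>\<^sub>0\<^sub>0\<close> and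
  \<open>coef u {x, y} = \<phi>\<^sub>0\<^sub>0 + \<phi>\<^sub>1\<^sub>1 - \<phi>\<^sub>0\<^sub>1 - \<phi>\<^sub>1\<^sub>0\<close>.
\<close>

definition coef :: "('n::finite set \<Rightarrow> real) \<Rightarrow> 'n set \<Rightarrow> real" where
  "coef u S = (\<Sum>T\<in>Pow S. (-1) ^ card (S - T) * u T)"

definition interp :: "('n::finite set \<Rightarrow> real) \<Rightarrow> real ^ 'n \<Rightarrow> real" where
  "interp u x = (\<Sum>S\<in>UNIV. coef u S * (\<Prod>\<gamma>\<in>S. x $ \<gamma>))"

section \<open>Cut cells, origin and local coordinates\<close>

definition cut_cell :: "('n set \<Rightarrow> real) \<Rightarrow> bool" where
  "cut_cell u \<longleftrightarrow> (\<exists>v. u v > 0) \<and> (\<exists>v. u v < 0)"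

definition neighbour :: "'n \<Rightarrow> 'n set \<Rightarrow> 'n set" where
  "neighbour \<gamma> v = (if \<gamma> \<in> v then v - {\<gamma>} else insert \<gamma> v)"

definition opposite :: "('n set \<Rightarrow> real) \<Rightarrow> 'n set \<Rightarrow> 'n \<Rightarrow> bool" where
  "opposite u v \<gamma> \<longleftrightarrow> u v * u (neighbour \<gamma> v) < 0"

text \<open>
  The condition \<open>u i \<noteq> 0\<close> matters only when no edge of the cell joins vertices of
  opposite sign, so that all vertices tie: ``the origin's side'' presupposes a sign there.
\<close>

definition is_origin :: "('n::finite set \<Rightarrow> real) \<Rightarrow> 'n set \<Rightarrow> bool" where
  "is_origin u i \<longleftrightarrow>
     u i \<noteq> 0 \<and> (\<forall>v. card {\<gamma>. opposite u v \<gamma>} \<le> card {\<gamma>. opposite u i \<gamma>})"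

definition edge_end :: "('n::finite set \<Rightarrow> real) \<Rightarrow> 'n set \<Rightarrow> 'n \<Rightarrow> real" where
  "edge_end u i \<gamma> =
     (if opposite u i \<gamma>
      then (THE t. 0 \<le> t \<and> t \<le> 1 \<and> interp u (\<chi> \<delta>. if \<delta> = \<gamma> then t else vcoord i \<delta>) = 0)
      else 1 - vcoord i \<gamma>)"

definition edge_length :: "('n::finite set \<Rightarrow> real) \<Rightarrow> 'n set \<Rightarrow> 'n \<Rightarrow> real" where
  "edge_length u i \<gamma> = \<bar>edge_end u i \<gamma> - vcoord i \<gamma>\<bar>"

section \<open>The analytical formulas for the cut volume\<close>

definition cut_volume_2 :: "('n::finite set \<Rightarrow> real) \<Rightarrow> 'n set \<Rightarrow> 'n \<Rightarrow> 'n \<Rightarrow> real" where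
  "cut_volume_2 u i \<eta> \<zeta> =
     (let a = coef u {\<eta>}; b = coef u {}; c = coef u {\<eta>, \<zeta>}; d = coef u {\<zeta>};
          \<eta>0 = min (edge_end u i \<eta>) (vcoord i \<eta>);
          \<eta>1 = max (edge_end u i \<eta>) (vcoord i \<eta>)
      in (1 - 2 * vcoord i \<zeta>) * integral {\<eta>0..\<eta>1} (\<lambda>t. - (a * t + b) / (c * t + d))
         + vcoord i \<zeta> * (\<eta>1 - \<eta>0))"

definition cut_volume_3 :: "('n::finite set \<Rightarrow> real) \<Rightarrow> 'n set \<Rightarrow> 'n \<Rightarrow> 'n \<Rightarrow> 'n \<Rightarrow> real" where
  "cut_volume_3 u i \<xi> \<eta> \<zeta> =
     (let a = coef u {\<xi>, \<eta>}; b = coef u {\<xi>}; c = coef u {\<eta>}; d = coef u {};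
          e = coef u {\<xi>, \<eta>, \<zeta>}; f = coef u {\<xi>, \<zeta>}; g = coef u {\<eta>, \<zeta>}; h = coef u {\<zeta>};
          i\<zeta> = vcoord i \<zeta>;
          q = (\<lambda>s. - ((f * i\<zeta> + b) * s + h * i\<zeta> + d) / ((e * i\<zeta> + a) * s + g * i\<zeta> + c));
          \<xi>0 = min (edge_end u i \<xi>) (vcoord i \<xi>);
          \<xi>1 = max (edge_end u i \<xi>) (vcoord i \<xi>);
          \<eta>0 = (\<lambda>s. if \<eta> \<in> i then q s else 0);
          \<eta>1 = (\<lambda>s. if \<eta> \<in> i then 1 else q s)
      in (1 - 2 * i\<zeta>) *
           integral {\<xi>0..\<xi>1} (\<lambda>s. integral {\<eta>0 s..\<eta>1 s}
             (\<lambda>t. (- s * (a * t + b) - c * t - d) / (s * (e * t + f) + g * t + h)))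
         + i\<zeta> * integral {\<xi>0..\<xi>1} (\<lambda>s. \<eta>1 s - \<eta>0 s))"

text \<open>The formulas give the volume on the origin's side; the fraction refers to the phase \<open>\<phi> > 0\<close>.\<close>

definition positive_part :: "('n set \<Rightarrow> real) \<Rightarrow> 'n set \<Rightarrow> real \<Rightarrow> real" where
  "positive_part u i V = (if u i > 0 then V else 1 - V)"

text \<open>An uncut cell lies in the negative phase also when all its vertex values vanish.\<close>

definition uncut_fraction :: "('n set \<Rightarrow> real) \<Rightarrow> real" where
  "uncut_fraction u = (if \<exists>v. u v > 0 then 1 else 0)"

section \<open>Elementary cells, splitting and resolved cells\<close>

text \<open>
  In the three-dimensional formula \<open>q(\<xi>)\<close> is the zero of the interpolant on the segment in
  direction \<open>\<eta>\<close> that starts on the \<open>\<xi>\<close>-edge through the origin. The formula describes the whole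
  origin's side when this edge carries all vertices on that side, that is, when the
  origin's side contains a single vertex or the two ends of one edge.
\<close>

definition elementary_config ::
    "('n::finite set \<Rightarrow> real) \<Rightarrow> 'n set \<Rightarrow> 'n \<Rightarrow> 'n \<Rightarrow> 'n \<Rightarrow> bool" where
  "elementary_config u i \<xi> \<eta> \<zeta> \<longleftrightarrow>
     is_origin u i \<and> \<xi> \<noteq> \<eta> \<and> \<xi> \<noteq> \<zeta> \<and> \<eta> \<noteq> \<zeta> \<and>
     edge_length u i \<eta> \<le> edge_length u i \<xi> \<and> edge_length u i \<zeta> \<le> edge_length u i \<eta> \<and>
     (\<forall>v. v \<noteq> i \<and> v \<noteq> neighbour \<xi> i \<longrightarrow> u v * u i \<le> 0)"

definition elementary :: "('n::finite set \<Rightarrow> real) \<Rightarrow> bool" where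
  "elementary u \<longleftrightarrow> (\<exists>i \<xi> \<eta> \<zeta>. elementary_config u i \<xi> \<eta> \<zeta>)"

text \<open>
  A part is a box \<open>K\<close> inside the unit cell. Rescaled to the unit cell it is again a cell, with
  the values of the interpolant at the corners of \<open>K\<close> as vertex values. A splitting is any
  finite subdivision of the unit cell into such boxes all of which are uncut or elementary;
  an elementary cell has the trivial splitting \<open>{cbox 0 1}\<close>.
\<close>

definition part_values :: "('n::finite set \<Rightarrow> real) \<Rightarrow> (real ^ 'n) set \<Rightarrow> 'n set \<Rightarrow> real" where
  "part_values u K v =
     interp u (\<chi> \<gamma>. if \<gamma> \<in> v then interval_upperbound K $ \<gamma> else interval_lowerbound K $ \<gamma>)"

definition splitting :: "('n::finite set \<Rightarrow> real) \<Rightarrow> (real ^ 'n) set set \<Rightarrow> bool" where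
  "splitting u D \<longleftrightarrow>
     D division_of cbox 0 1 \<and>
     (\<forall>K\<in>D. cut_cell (part_values u K) \<longrightarrow> elementary (part_values u K))"

text \<open>
  In two dimensions the interface of a cut cell is ambiguous when it crosses all four edges,
  that is, when the two diagonals carry opposite signs.
\<close>

definition resolved :: "('n::finite set \<Rightarrow> real) \<Rightarrow> bool" where
  "resolved u \<longleftrightarrow>
     (if CARD('n) = 2 then \<not> (\<forall>v \<gamma>. opposite u v \<gamma>) else (\<exists>D. splitting u D))"

section \<open>Volume fraction computed in a cell\<close>

text \<open>
  These are relations rather than functions, since ties in the choice of the origin and of the
  directions, and the choice of the splitting, are left open.
\<close>

inductive part_fraction :: "('n::finite set \<Rightarrow> real) \<Rightarrow> real \<Rightarrow> bool" where
  uncut_part: "\<not> cut_cell u \<Longrightarrow> part_fraction u (uncut_fraction u)"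
| elementary_part: "cut_cell u \<Longrightarrow> elementary_config u i \<xi> \<eta> \<zeta> \<Longrightarrow>
    part_fraction u (positive_part u i (cut_volume_3 u i \<xi> \<eta> \<zeta>))"

inductive volume_fraction :: "('n::finite set \<Rightarrow> real) \<Rightarrow> real \<Rightarrow> bool" where
  uncut: "\<not> cut_cell u \<Longrightarrow> volume_fraction u (uncut_fraction u)"
| cut_2: "CARD('n) = 2 \<Longrightarrow> cut_cell u \<Longrightarrow> is_origin u i \<Longrightarrow> \<eta> \<noteq> \<zeta> \<Longrightarrow>
    edge_length u i \<zeta> \<le> edge_length u i \<eta> \<Longrightarrow>
    volume_fraction u (positive_part u i (cut_volume_2 u i \<eta> \<zeta>))"
| cut_3: "CARD('n) = 3 \<Longrightarrow> cut_cell (u :: 'n set \<Rightarrow> real) \<Longrightarrow> splitting u D \<Longrightarrow>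
    (\<And>K. K \<in> D \<Longrightarrow> part_fraction (part_values u K) (w K)) \<Longrightarrow>
    volume_fraction u (\<Sum>K\<in>D. measure lborel K * w K)"

section \<open>Cartesian meshes and their refinement\<close>

text \<open>
  A level-0 mesh is a finite set \<open>C\<close> of cell indices. The level-\<open>k\<close> cell with index \<open>c\<close> and the
  level-\<open>k\<close> vertex with index \<open>p\<close> have lower corner, respectively position,
  \<open>x\<^sub>0 + h c / 2 ^ k\<close> and \<open>x\<^sub>0 + h p / 2 ^ k\<close> (componentwise).
\<close>

primrec mesh :: "(int ^ 'n) set \<Rightarrow> nat \<Rightarrow> (int ^ 'n) set" where
  "mesh C 0 = C"
| "mesh C (Suc k) = {(\<chi> \<gamma>. 2 * c $ \<gamma> + of_bool (\<gamma> \<in> s)) | c s. c \<in> mesh C k}"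

definition cell_box :: "real ^ 'n \<Rightarrow> real ^ 'n \<Rightarrow> nat \<Rightarrow> int ^ 'n \<Rightarrow> (real ^ 'n) set" where
  "cell_box x0 h k c =
     cbox (\<chi> \<gamma>. x0 $ \<gamma> + h $ \<gamma> * of_int (c $ \<gamma>) / 2 ^ k)
          (\<chi> \<gamma>. x0 $ \<gamma> + h $ \<gamma> * of_int (c $ \<gamma> + 1) / 2 ^ k)"

definition mesh_domain :: "real ^ 'n \<Rightarrow> real ^ 'n \<Rightarrow> (int ^ 'n) set \<Rightarrow> (real ^ 'n) set" where
  "mesh_domain x0 h C = (\<Union>c\<in>C. cell_box x0 h 0 c)"

definition cell_values :: "(int ^ 'n \<Rightarrow> real) \<Rightarrow> int ^ 'n \<Rightarrow> 'n set \<Rightarrow> real" where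
  "cell_values \<phi> c v = \<phi> (\<chi> \<gamma>. c $ \<gamma> + of_bool (\<gamma> \<in> v))"

text \<open>
  The refined vertices in the level-\<open>k\<close> cell \<open>c\<close> have index \<open>2 c + s\<close> with entries of \<open>s\<close> in
  \<open>{0, 1, 2}\<close> and local coordinates \<open>s / 2\<close>.
\<close>

definition interpolation_refinement ::
    "(int ^ 'n::finite) set \<Rightarrow> nat \<Rightarrow> (int ^ 'n \<Rightarrow> real) \<Rightarrow> (int ^ 'n \<Rightarrow> real) \<Rightarrow> bool" where
  "interpolation_refinement C k \<phi> \<phi>' \<longleftrightarrow>
     (\<forall>c\<in>mesh C k. \<forall>s. (\<forall>\<gamma>. s $ \<gamma> \<in> {0, 1, 2}) \<longrightarrow>
        \<phi>' (\<chi> \<gamma>. 2 * c $ \<gamma> + s $ \<gamma>) =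
        interp (cell_values \<phi> c) (\<chi> \<gamma>. of_int (s $ \<gamma>) / 2))"

text \<open>The values of the field on the (null) cell boundaries are left open.\<close>

definition volume_fraction_field ::
    "real ^ 'n \<Rightarrow> real ^ 'n \<Rightarrow> (int ^ 'n::finite) set \<Rightarrow> nat \<Rightarrow> (int ^ 'n \<Rightarrow> real)
      \<Rightarrow> (real ^ 'n \<Rightarrow> real) \<Rightarrow> bool" where
  "volume_fraction_field x0 h C k \<phi> A \<longleftrightarrow>
     (\<forall>c\<in>mesh C k. \<exists>a. volume_fraction (cell_values \<phi> c) a \<and>
        (\<forall>x\<in>interior (cell_box x0 h k c). A x = a))"

end

theory Submission
  imports Defs
begin

text \<open>
  The fraction of every resolved cell is the exact volume of \<open>{x \<in> [0,1]\<^sup>n. \<phi>(x) > 0}\<close>: slicing a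
  cell orthogonally to a direction gives again a cell (with interpolated vertex values), so by
  Fubini's theorem the volume is an iterated integral of slice volumes, and on the origin's side
  the innermost slices are segments with exactly one zero of the interpolant. Restricting a
  multilinear interpolant to a subbox gives the interpolant of its values at the corners of the
  subbox; hence exact volumes are additive under subdivision, both for splittings into elementary
  parts and for mesh refinement.
\<close>

section \<open>Multiaffine functions\<close>

text \<open>The formulas are written with \<open>integral\<close>, which is 0 by default on
  non-integrable functions, so integrability has to be proved, and the integrands are quotients
  whose denominators may vanish at the ends of the range. The logarithmic closed forms never have to
  be handled: each integrand equals, off finitely many points, an affine expression in exact volumes
  of slices, and Fubini's theorem gives both integrability and value of those.

  The formulas measure the origin's side, whatever its sign. They are matched with the exact volume
  for a positive origin; a negative one is reached by passing from \<open>u\<close> to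
  \<open>-u\<close>, which leaves the formulas unchanged, and taking complements, which requires the
  interface to be a null set.

  It must also be known that the positive part of each inner segment is attached to the origin's
  side. In three dimensions this is built into elementary cells; in two it has to be derived from
  the choice of the origin, the order of the edge lengths and the exclusion of the ambiguous sign
  pattern.\<close>

definition set_coord :: "real ^ 'n \<Rightarrow> 'n \<Rightarrow> real \<Rightarrow> real ^ 'n" where
  "set_coord x \<gamma> t = (\<chi> \<delta>. if \<delta> = \<gamma> then t else x $ \<delta>)"

definition vertex :: "'n set \<Rightarrow> real ^ 'n" where
  "vertex v = (\<chi> \<gamma>. vcoord v \<gamma>)"

text \<open>
  The vertex values on the slice \<open>x\<^sub>\<gamma> = t\<close>, extended constantly in direction \<open>\<gamma>\<close>, so that slices are
  again cells of the same dimension.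
\<close>

definition slice :: "'n \<Rightarrow> real \<Rightarrow> ('n set \<Rightarrow> real) \<Rightarrow> 'n set \<Rightarrow> real" where
  "slice \<gamma> t u v = (1 - t) * u (v - {\<gamma>}) + t * u (insert \<gamma> v)"

text \<open>Affine along every coordinate line, expressed through the points with that coordinate 0
  and 1. Identities between interpolants can then be checked at the vertices, without computing with
  \<open>coef\<close>.\<close>

definition multiaffine :: "(real ^ 'n \<Rightarrow> real) \<Rightarrow> bool" where
  "multiaffine F \<longleftrightarrow>
     (\<forall>x \<gamma> t. F (set_coord x \<gamma> t) = (1 - t) * F (set_coord x \<gamma> 0) + t * F (set_coord x \<gamma> 1))"

lemma set_coord_nth [simp]: "set_coord x \<gamma> t $ \<delta> = (if \<delta> = \<gamma> then t else x $ \<delta>)"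
  by (simp add: set_coord_def)

lemma vertex_nth [simp]: "vertex v $ \<gamma> = of_bool (\<gamma> \<in> v)"
  by (simp add: vertex_def vcoord_def)

lemma set_coord_same [simp]: "set_coord x \<gamma> (x $ \<gamma>) = x"
  by (simp add: vec_eq_iff)

lemma set_coord_twice [simp]: "set_coord (set_coord x \<gamma> s) \<gamma> t = set_coord x \<gamma> t"
  by (simp add: vec_eq_iff)

lemma set_coord_commute:
  "\<gamma> \<noteq> \<delta> \<Longrightarrow> set_coord (set_coord x \<gamma> s) \<delta> t = set_coord (set_coord x \<delta> t) \<gamma> s"
  by (auto simp: vec_eq_iff)

lemma set_coord_vertex:
  "set_coord (vertex v) \<gamma> 0 = vertex (v - {\<gamma>})" "set_coord (vertex v) \<gamma> 1 = vertex (insert \<gamma> v)"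
  by (auto simp: vec_eq_iff)

lemma mem_unit_cbox: "x \<in> cbox 0 (1 :: real ^ 'n::finite) \<longleftrightarrow> (\<forall>\<gamma>. 0 \<le> x $ \<gamma> \<and> x $ \<gamma> \<le> 1)"
  by (simp add: mem_box_cart)

lemma multiaffineD:
  "multiaffine F \<Longrightarrow>
    F (set_coord x \<gamma> t) = (1 - t) * F (set_coord x \<gamma> 0) + t * F (set_coord x \<gamma> 1)"
  unfolding multiaffine_def by blast

text \<open>The induction runs over the set \<open>G\<close> of coordinates that may differ from 0
  and 1; moving \<open>x\<close> to the two ends in direction \<gamma> removes \<gamma> from it.
  Since \<open>x\<close> ranges over the whole space, identities obtained this way hold outside the
  cube too.\<close>

lemma vertex_induct [case_names vertex segment]:
  fixes x :: "real ^ 'n::finite"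
  assumes vertex: "\<And>v. P (vertex v)"
    and segment: "\<And>x \<gamma>. P (set_coord x \<gamma> 0) \<Longrightarrow> P (set_coord x \<gamma> 1) \<Longrightarrow> P x"
  shows "P x"
proof -
  have "\<forall>x. (\<forall>\<gamma>. \<gamma> \<notin> G \<longrightarrow> x $ \<gamma> \<in> {0, 1}) \<longrightarrow> P x" for G :: "'n set"
    using finite[of G]
  proof (induction G rule: finite_induct)
    case empty
    have "x = vertex {\<gamma>. x $ \<gamma> = 1}" if "\<forall>\<gamma>. x $ \<gamma> \<in> {0, 1}" for x :: "real ^ 'n"
      using that by (auto simp: vec_eq_iff)
    then show ?case
      by (metis empty_iff vertex)
  next
    case (insert \<gamma> G)
    show ?case
    proof (intro allI impI)
      fix x :: "real ^ 'n"
      assume "\<forall>\<delta>. \<delta> \<notin> insert \<gamma> G \<longrightarrow> x $ \<delta> \<in> {0, 1}"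
      then show "P x"
        using insert.IH by (intro segment[of x \<gamma>]) simp_all
    qed
  qed
  from this[of UNIV] show ?thesis by simp
qed

lemma multiaffine_eqI:
  fixes F G :: "real ^ 'n::finite \<Rightarrow> real"
  assumes "multiaffine F" "multiaffine G" "\<And>v. F (vertex v) = G (vertex v)"
  shows "F x = G x"
proof (induction x rule: vertex_induct)
  case (segment x \<gamma>)
  then show ?case
    using multiaffineD[OF assms(1), of x \<gamma> "x $ \<gamma>"] multiaffineD[OF assms(2), of x \<gamma> "x $ \<gamma>"]
    by simp
qed (fact assms)

text \<open>In the cube the weights \<open>1 - x $ \<gamma>\<close> and \<open>x $ \<gamma>\<close>
  are nonnegative, so signs propagate from the vertices; setting a coordinate to 0 or 1 does not
  leave the cube.\<close>

lemma multiaffine_nonneg: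
  fixes F :: "real ^ 'n::finite \<Rightarrow> real"
  assumes F: "multiaffine F" and "\<And>v. F (vertex v) \<ge> 0" and "x \<in> cbox 0 1"
  shows "F x \<ge> 0"
  using assms(3)
proof (induction x rule: vertex_induct)
  case (segment x \<gamma>)
  have "F x = (1 - x $ \<gamma>) * F (set_coord x \<gamma> 0) + x $ \<gamma> * F (set_coord x \<gamma> 1)"
    using F by (metis multiaffine_def set_coord_same)
  then show ?case
    using segment by (auto simp: mem_unit_cbox)
qed (use assms in simp)

section \<open>Interpolants as multiaffine functions\<close>

lemma multiaffine_interp: "multiaffine (interp u)"
  unfolding multiaffine_def
proof (intro allI)
  fix x :: "real ^ 'a" and \<gamma> t
  \<comment> \<open>A monomial contains the variable of direction \<gamma> at most once, so it is
    linear or constant in it.\<close>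
  have prod_affine: "(\<Prod>\<delta>\<in>S. set_coord x \<gamma> t $ \<delta>) =
      (1 - t) * (\<Prod>\<delta>\<in>S. set_coord x \<gamma> 0 $ \<delta>) + t * (\<Prod>\<delta>\<in>S. set_coord x \<gamma> 1 $ \<delta>)" for S
  proof (cases "\<gamma> \<in> S")
    case True
    have "(\<Prod>\<delta>\<in>S. set_coord x \<gamma> r $ \<delta>) = r * (\<Prod>\<delta>\<in>S - {\<gamma>}. x $ \<delta>)" for r
      using True by (simp add: prod.remove[OF _ True])
    then show ?thesis by simp
  next
    case False
    then have "(\<Prod>\<delta>\<in>S. set_coord x \<gamma> r $ \<delta>) = (\<Prod>\<delta>\<in>S. x $ \<delta>)" for r
      by (intro prod.cong) auto
    then show ?thesis by (simp add: algebra_simps)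
  qed
  show "interp u (set_coord x \<gamma> t) =
      (1 - t) * interp u (set_coord x \<gamma> 0) + t * interp u (set_coord x \<gamma> 1)"
    unfolding interp_def sum_distrib_left sum.distrib[symmetric] prod_affine
    by (intro sum.cong refl) algebra
qed

text \<open>At the vertex \<open>v\<close> the monomials with \<open>S \<subseteq> v\<close> equal 1
  and all others vanish; summing \<open>coef\<close> over the subsets of \<open>v\<close> is Moebius
  inversion on the subset lattice.\<close>

lemma interp_vertex [simp]: "interp u (vertex v) = u v"
proof -
  \<comment> \<open>Splitting the sign into \<open>(-1) ^ card S\<close> and
    \<open>(-1) ^ card T\<close> brings \<open>coef\<close> into the symmetric form of
    inclusion-exclusion, where \<open>u\<close> and \<open>g\<close> can be interchanged.\<close>
  define g where "g S = (\<Sum>T\<in>Pow S. (-1) ^ card T * u T)" for S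
  have coef_g: "coef u S = (-1) ^ card S * g S" for S
  proof -
    have "(-1::real) ^ card (S - T) = (-1) ^ card S * (-1) ^ card T" if "T \<subseteq> S" for T
    proof -
      have "card S = card (S - T) + card T"
        using that by (metis card_Diff_subset card_mono finite le_add_diff_inverse2)
      then show ?thesis
        by (simp add: power_add)
    qed
    then show ?thesis
      unfolding coef_def g_def sum_distrib_left by (intro sum.cong) auto
  qed
  have "interp u (vertex v) = (\<Sum>S\<in>Pow v. coef u S)"
    unfolding interp_def
  proof (rule sum.mono_neutral_cong_right)
    show "\<forall>S\<in>UNIV - Pow v. coef u S * (\<Prod>\<gamma>\<in>S. vertex v $ \<gamma>) = 0"
      by auto
    show "coef u S * (\<Prod>\<gamma>\<in>S. vertex v $ \<gamma>) = coef u S" if "S \<in> Pow v" for S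
    proof -
      have "(\<Prod>\<gamma>\<in>S. vertex v $ \<gamma>) = 1"
        using that by (intro prod.neutral) auto
      then show ?thesis by simp
    qed
  qed auto
  also have "\<dots> = u v"
    using inclusion_exclusion_symmetric[of g u v] by (simp add: coef_g g_def)
  finally show ?thesis .
qed

lemma interp_eqI:
  "multiaffine F \<Longrightarrow> (\<And>v. F (vertex v) = u v) \<Longrightarrow> interp u x = F x"
  by (rule multiaffine_eqI[OF multiaffine_interp]) auto

text \<open>This turns slicing a region into an operation on vertex values: freezing a coordinate
  preserves multiaffinity, and affinity along an edge yields \<open>slice\<close> at the
  vertices.\<close>

lemma interp_set_coord: "interp u (set_coord x \<gamma> t) = interp (slice \<gamma> t u) x"
proof (rule sym, rule interp_eqI)
  show "multiaffine (\<lambda>x. interp u (set_coord x \<gamma> t))"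
    unfolding multiaffine_def
  proof (intro allI)
    fix x \<delta> s
    show "interp u (set_coord (set_coord x \<delta> s) \<gamma> t) =
      (1 - s) * interp u (set_coord (set_coord x \<delta> 0) \<gamma> t) +
      s * interp u (set_coord (set_coord x \<delta> 1) \<gamma> t)"
    proof (cases "\<delta> = \<gamma>")
      case True
      then show ?thesis by (simp add: algebra_simps)
    next
      case False
      show ?thesis
        unfolding set_coord_commute[OF False] by (rule multiaffineD[OF multiaffine_interp])
    qed
  qed
  show "interp u (set_coord (vertex v) \<gamma> t) = slice \<gamma> t u v" for v
  proof -
    have "interp u (set_coord (vertex v) \<gamma> t) = (1 - t) * interp u (set_coord (vertex v) \<gamma> 0)
        + t * interp u (set_coord (vertex v) \<gamma> 1)"
      by (rule multiaffineD[OF multiaffine_interp])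
    then show ?thesis
      by (simp only: set_coord_vertex interp_vertex slice_def)
  qed
qed

text \<open>The rescaling acts affinely on each coordinate separately, so the composition stays
  multiaffine and is determined by its values at the corners of the box.\<close>

lemma interp_box:
  fixes a b y :: "real ^ 'n::finite"
  assumes "cbox a b \<noteq> {}"
  shows "interp (part_values u (cbox a b)) y = interp u (\<chi> \<gamma>. a $ \<gamma> + (b $ \<gamma> - a $ \<gamma>) * y $ \<gamma>)"
proof (rule interp_eqI)
  let ?f = "\<lambda>y. (\<chi> \<gamma>. a $ \<gamma> + (b $ \<gamma> - a $ \<gamma>) * y $ \<gamma>)"
  show "multiaffine (\<lambda>y. interp u (?f y))"
    unfolding multiaffine_def
  proof (intro allI)
    fix x :: "real ^ 'n" and \<gamma> and t :: real
    let ?l = "\<lambda>t. a $ \<gamma> + (b $ \<gamma> - a $ \<gamma>) * t"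
    have *: "?f (set_coord x \<gamma> t) = set_coord (?f x) \<gamma> (?l t)" for t
      by (simp add: vec_eq_iff)
    have M: "interp u (set_coord (?f x) \<gamma> r) =
        (1 - r) * interp u (set_coord (?f x) \<gamma> 0) + r * interp u (set_coord (?f x) \<gamma> 1)" for r
      by (rule multiaffineD[OF multiaffine_interp])
    show "interp u (?f (set_coord x \<gamma> t)) =
        (1 - t) * interp u (?f (set_coord x \<gamma> 0)) + t * interp u (?f (set_coord x \<gamma> 1))"
      unfolding * M[of "?l t"] M[of "?l 0"] M[of "?l 1"] by algebra
  qed
  have "interval_lowerbound (cbox a b) = a" "interval_upperbound (cbox a b) = b"
    using assms by simp_all
  then show "interp u (?f (vertex v)) = part_values u (cbox a b) v" for v
    unfolding part_values_def by (intro arg_cong[where f = "interp u"]) (auto simp: vec_eq_iff)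
qed

lemma interp_const: "(\<And>v. u v = c) \<Longrightarrow> interp u x = c"
  by (rule interp_eqI) (auto simp: multiaffine_def algebra_simps)

lemma interp_uminus: "interp (\<lambda>v. - u v) x = - interp u x"
proof (rule interp_eqI)
  show "multiaffine (\<lambda>x. - interp u x)"
    unfolding multiaffine_def
  proof (intro allI)
    fix x \<gamma> t
    show "- interp u (set_coord x \<gamma> t) =
        (1 - t) * - interp u (set_coord x \<gamma> 0) + t * - interp u (set_coord x \<gamma> 1)"
      using multiaffineD[OF multiaffine_interp[of u], of x \<gamma> t] by linarith
  qed
qed simp

lemma continuous_on_interp: "continuous_on S (interp u)"
  unfolding interp_def by (intro continuous_intros)

section \<open>Slicing the unit cube\<close>

text \<open>Gives access to the product measure over the index set, from which a single coordinate
  can be split off. Agreement on boxes determines the measure.\<close>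

lemma lborel_vec_eq_distr:
  "(lborel :: (real ^ 'n::finite) measure) = distr (Pi\<^sub>M UNIV (\<lambda>_. lborel)) borel vec_lambda"
    (is "_ = ?M")
proof (rule lborel_eqI)
  have meas: "(vec_lambda :: ('n \<Rightarrow> real) \<Rightarrow> _) \<in> borel_measurable (Pi\<^sub>M UNIV (\<lambda>_. lborel))"
    by (rule borel_measurable_euclidean_space[THEN iffD2]) (auto simp: Basis_vec_def inner_axis)
  interpret finite_product_sigma_finite "\<lambda>_::'n. lborel :: real measure" UNIV
    by standard auto
  fix l u :: "real ^ 'n"
  assume le: "\<And>b. b \<in> Basis \<Longrightarrow> l \<bullet> b \<le> u \<bullet> b"
  then have le': "l $ \<gamma> \<le> u $ \<gamma>" for \<gamma>
    using le[of "axis \<gamma> 1"] by (simp add: axis_in_Basis_iff inner_axis)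
  have "emeasure ?M (box l u) = emeasure (Pi\<^sub>M UNIV (\<lambda>_::'n. lborel)) (\<Pi>\<^sub>E \<gamma>\<in>UNIV. {l $ \<gamma> <..< u $ \<gamma>})"
    by (subst emeasure_distr[OF meas])
       (auto simp: mem_box_cart space_PiM PiE_UNIV_domain Pi_iff intro!: arg_cong2[where f = emeasure])
  also have "\<dots> = ennreal (\<Prod>\<gamma>\<in>UNIV. u $ \<gamma> - l $ \<gamma>)"
    using le' by (subst emeasure_PiM) (auto simp: prod_ennreal)
  also have "(\<Prod>\<gamma>\<in>UNIV. u $ \<gamma> - l $ \<gamma>) = (\<Prod>b\<in>Basis. (u - l) \<bullet> b)"
    by (rule prod.reindex_bij_witness[of _ axis_index "\<lambda>\<gamma>. axis \<gamma> 1"])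
       (auto simp: Basis_vec_def axis_index_axis inner_axis)
  finally show "emeasure ?M (box l u) = (\<Prod>b\<in>Basis. (u - l) \<bullet> b)" .
qed simp

lemma emeasure_unit_cbox: "emeasure lborel (cbox 0 (1 :: real ^ 'n::finite)) = 1"
proof -
  have "emeasure lborel (cbox 0 (1 :: real ^ 'n)) = (\<Prod>b\<in>Basis. (1 :: real ^ 'n) \<bullet> b)"
    by (subst emeasure_lborel_cbox) (auto simp: Basis_vec_def inner_axis)
  also have "(\<Prod>b\<in>Basis. (1 :: real ^ 'n) \<bullet> b) = 1"
    by (rule prod.neutral) (auto simp: Basis_vec_def inner_axis)
  finally show ?thesis by simp
qed

lemma continuous_on_set_coord:
  assumes "continuous_on S f" "continuous_on S g"
  shows "continuous_on S (\<lambda>x. set_coord (f x) \<gamma> (g x))"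
  unfolding set_coord_def
proof (rule continuous_on_vec_lambda)
  show "continuous_on S (\<lambda>x. if \<delta> = \<gamma> then g x else f x $ \<delta>)" for \<delta>
    by (cases "\<delta> = \<gamma>") (use assms in \<open>auto intro!: continuous_intros\<close>)
qed

lemma measurable_set_coord_pair:
  "(\<lambda>(t, x :: real ^ 'n::finite). set_coord x \<gamma> t) \<in> borel_measurable (borel \<Otimes>\<^sub>M borel)"
  by (simp add: borel_prod case_prod_beta borel_measurable_continuous_onI continuous_on_set_coord
      continuous_on_fst continuous_on_snd continuous_on_id)

lemma measurable_set_coord [measurable]:
  "(\<lambda>x :: real ^ 'n::finite. set_coord x \<gamma> t) \<in> borel_measurable borel"
  by (intro borel_measurable_continuous_onI continuous_on_set_coord continuous_intros)

text \<open>
  Fubini's theorem without a change of dimension: the inner integral also runs over the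
  replaced coordinate, on which its integrand does not depend.
\<close>

lemma emeasure_unit_cbox_slices:
  fixes A :: "(real ^ 'n::finite) set"
  assumes A: "A \<in> sets borel"
  shows "emeasure lborel (cbox 0 1 \<inter> A) =
    (\<integral>\<^sup>+t. indicator {0..1} t * emeasure lborel (cbox 0 1 \<inter> {x. set_coord x \<gamma> t \<in> A}) \<partial>lborel)"
proof -
  define I where "I = UNIV - {\<gamma>}"
  have I: "finite I" "\<gamma> \<notin> I" "insert \<gamma> I = UNIV"
    by (auto simp: I_def)
  interpret product_sigma_finite "\<lambda>_::'n. lborel :: real measure"
    by standard
  have vec_meas [measurable]:
    "(vec_lambda :: ('n \<Rightarrow> real) \<Rightarrow> _) \<in> borel_measurable (Pi\<^sub>M UNIV (\<lambda>_. lborel))"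
    by (rule borel_measurable_euclidean_space[THEN iffD2]) (auto simp: Basis_vec_def inner_axis)
  have fubini: "emeasure lborel B =
      (\<integral>\<^sup>+t. \<integral>\<^sup>+f. indicator B (vec_lambda (f(\<gamma> := t))) \<partial>Pi\<^sub>M I (\<lambda>_. lborel) \<partial>lborel)"
    if [measurable]: "B \<in> sets borel" for B :: "(real ^ 'n) set"
  proof -
    have "emeasure lborel B = (\<integral>\<^sup>+x. indicator B x \<partial>lborel)"
      by simp
    also have "\<dots> = (\<integral>\<^sup>+f. indicator B (vec_lambda f) \<partial>Pi\<^sub>M (insert \<gamma> I) (\<lambda>_. lborel))"
      unfolding I by (subst lborel_vec_eq_distr, subst nn_integral_distr) auto
    also have "\<dots> = (\<integral>\<^sup>+t. \<integral>\<^sup>+f. indicator B (vec_lambda (f(\<gamma> := t))) \<partial>Pi\<^sub>M I (\<lambda>_. lborel) \<partial>lborel)"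
      by (rule product_nn_integral_insert_rev[OF I(1,2)]) (unfold I(3), measurable)
    finally show ?thesis .
  qed
  \<comment> \<open>\<open>G t\<close> is the indicator of the slice in the coordinates other than
    \<gamma>. In all coordinates the slice only acquires the factor
    \<open>indicator {0..1} s\<close> for the replaced one, of integral 1.\<close>
  define G :: "real \<Rightarrow> ('n \<Rightarrow> real) \<Rightarrow> ennreal" where
    "G t f = of_bool ((\<forall>\<delta>\<in>I. 0 \<le> f \<delta> \<and> f \<delta> \<le> 1) \<and> vec_lambda (f(\<gamma> := t)) \<in> A)" for t f
  have "emeasure lborel (cbox 0 1 \<inter> {x. set_coord x \<gamma> t \<in> A}) = (\<integral>\<^sup>+f. G t f \<partial>Pi\<^sub>M I (\<lambda>_. lborel))"
    for t
  proof -
    have B: "cbox 0 1 \<inter> {x. set_coord x \<gamma> t \<in> A} \<in> sets borel"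
      using A by measurable
    have upd [simp]: "set_coord (vec_lambda (f(\<gamma> := s))) \<gamma> t = vec_lambda (f(\<gamma> := t))" for s and f :: "'n \<Rightarrow> real"
      by (simp add: vec_eq_iff)
    have cube: "vec_lambda (f(\<gamma> := s)) \<in> cbox 0 1 \<longleftrightarrow>
        s \<in> {0..1} \<and> (\<forall>\<delta>\<in>I. 0 \<le> f \<delta> \<and> f \<delta> \<le> 1)" for s and f :: "'n \<Rightarrow> real"
      by (auto simp: mem_unit_cbox I_def)
    have "indicator (cbox 0 1 \<inter> {x. set_coord x \<gamma> t \<in> A}) (vec_lambda (f(\<gamma> := s))) = G t f * indicator {0..1} s"
      for s f
      by (auto simp: G_def indicator_def upd cube)
    then have "emeasure lborel (cbox 0 1 \<inter> {x. set_coord x \<gamma> t \<in> A}) =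
       (\<integral>\<^sup>+(s::real). \<integral>\<^sup>+f. G t f * indicator {0..1} s \<partial>Pi\<^sub>M I (\<lambda>_. lborel) \<partial>lborel)"
      unfolding fubini[OF B] by simp
    also have "\<dots> = (\<integral>\<^sup>+(s::real). (\<integral>\<^sup>+f. G t f \<partial>Pi\<^sub>M I (\<lambda>_. lborel)) * indicator {0..1} s \<partial>lborel)"
      by (intro nn_integral_cong) (auto split: split_indicator)
    also have "\<dots> = (\<integral>\<^sup>+f. G t f \<partial>Pi\<^sub>M I (\<lambda>_. lborel))"
      by (simp add: nn_integral_cmult_indicator)
    finally show ?thesis .
  qed
  moreover have "emeasure lborel (cbox 0 1 \<inter> A) =
      (\<integral>\<^sup>+t. indicator {0..1} t * (\<integral>\<^sup>+f. G t f \<partial>Pi\<^sub>M I (\<lambda>_. lborel)) \<partial>lborel)"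
  proof -
    have "indicator (cbox 0 1 \<inter> A) (vec_lambda (f(\<gamma> := t))) = indicator {0..1} t * G t f" for t f
      by (auto simp: G_def indicator_def mem_unit_cbox I_def)
    then show ?thesis
      using A by (subst fubini) (auto intro!: nn_integral_cong split: split_indicator)
  qed
  ultimately show ?thesis
    by simp
qed

lemma emeasure_unit_cbox_le: "A \<in> sets borel \<Longrightarrow> emeasure lborel (cbox 0 (1 :: real ^ 'n::finite) \<inter> A) \<le> 1"
  by (subst emeasure_unit_cbox[symmetric]) (rule emeasure_mono, auto)

text \<open>The extended-valued slice formula becomes a \<open>has_integral\<close> statement
  because the slice measures are bounded by the cube and measurable in \<open>t\<close>.\<close>

lemma measure_unit_cbox_slices:
  fixes A :: "(real ^ 'n::finite) set"
  assumes A: "A \<in> sets borel"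
  shows "((\<lambda>t. measure lborel (cbox 0 1 \<inter> {x. set_coord x \<gamma> t \<in> A})) has_integral
    measure lborel (cbox 0 1 \<inter> A)) {0..1}"
proof -
  define m where "m t = measure lborel (cbox 0 1 \<inter> {x. set_coord x \<gamma> t \<in> A})" for t
  have sets: "{x. set_coord x \<gamma> t \<in> A} \<in> sets borel" for t
    using measurable_sets[OF measurable_set_coord A, of \<gamma> t] by (simp add: vimage_def)
  have fin: "emeasure lborel (cbox 0 1 \<inter> B) = ennreal (measure lborel (cbox 0 1 \<inter> B))"
    if "B \<in> sets borel" for B :: "(real ^ 'n) set"
    using emeasure_unit_cbox_le[OF that]
    by (intro emeasure_eq_ennreal_measure) (auto simp: top_unique)
  \<comment> \<open>The sections of \<open>Q\<close> are the slices, so measurability of their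
    measure in \<open>t\<close> follows from that of \<open>Q\<close> as a set of pairs.\<close>
  define Q where "Q = {p \<in> space (borel \<Otimes>\<^sub>M borel). (case p of (t, x) \<Rightarrow> set_coord x \<gamma> t) \<in> A}
    \<inter> UNIV \<times> cbox 0 1"
  have "Q \<in> sets (borel \<Otimes>\<^sub>M lborel)"
    unfolding Q_def
    using measurable_sets[OF measurable_set_coord_pair A, of \<gamma>]
    by (intro sets.Int) (auto simp: vimage_def Int_def conj_commute cong: sets_pair_measure_cong)
  then have "(\<lambda>t. emeasure lborel (Pair t -` Q)) \<in> borel_measurable borel"
    by (rule lborel.measurable_emeasure_Pair)
  moreover have "Pair t -` Q = cbox 0 1 \<inter> {x. set_coord x \<gamma> t \<in> A}" for t
    by (auto simp: Q_def space_pair_measure)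
  moreover have "m = (\<lambda>t. enn2real (emeasure lborel (cbox 0 1 \<inter> {x. set_coord x \<gamma> t \<in> A})))"
    by (simp add: fun_eq_iff m_def measure_def)
  ultimately have m [measurable]: "m \<in> borel_measurable borel"
    by simp
  have "((\<lambda>t. indicator {0..1} t * m t) has_integral measure lborel (cbox 0 1 \<inter> A)) UNIV"
  proof (rule nn_integral_has_integral)
    have "(\<integral>\<^sup>+t. ennreal (indicator {0..1} t * m t) \<partial>lborel) = emeasure lborel (cbox 0 1 \<inter> A)"
      unfolding emeasure_unit_cbox_slices[OF A, of \<gamma>] fin[OF sets] m_def
      by (intro nn_integral_cong) (auto split: split_indicator)
    then show "(\<integral>\<^sup>+t. ennreal (indicator {0..1} t * m t) \<partial>lborel) = ennreal (measure lborel (cbox 0 1 \<inter> A))"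
      by (simp add: fin[OF A])
    show "0 \<le> indicator {0..1} t * m t" for t
      by (simp add: m_def)
  qed simp_all
  moreover have "(\<lambda>t. indicator {0..1} t * m t) = (\<lambda>t. if t \<in> {0..1} then m t else 0)"
    by (auto simp: fun_eq_iff)
  ultimately have "((\<lambda>t. if t \<in> {0..1} then m t else 0) has_integral measure lborel (cbox 0 1 \<inter> A)) UNIV"
    by metis
  then show ?thesis
    unfolding has_integral_restrict_UNIV m_def .
qed

text \<open>The exact quantity with which all formulas are compared. By the strict inequality a cell
  whose vertex values all vanish gets volume 0, in agreement with \<open>uncut_fraction\<close>; in
  all other cells the zero set is null.\<close>

definition phase_volume :: "('n::finite set \<Rightarrow> real) \<Rightarrow> real" where
  "phase_volume u = measure lborel (cbox 0 1 \<inter> {x. 0 < interp u x})"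

lemma borel_measurable_interp [measurable]: "interp u \<in> borel_measurable borel"
  by (rule borel_measurable_continuous_onI[OF continuous_on_interp])

lemma volume_slices: "((\<lambda>t. phase_volume (slice \<gamma> t u)) has_integral phase_volume u) {0..1}"
  using measure_unit_cbox_slices[of "{x. 0 < interp u x}" \<gamma>]
  by (simp add: phase_volume_def interp_set_coord)

lemma zero_set_slices:
  "((\<lambda>t. measure lborel (cbox 0 1 \<inter> {x. interp (slice \<gamma> t u) x = 0})) has_integral
    measure lborel (cbox 0 1 \<inter> {x. interp u x = 0})) {0..1}"
  using measure_unit_cbox_slices[of "{x. interp u x = 0}" \<gamma>]
  by (simp add: interp_set_coord)

text \<open>Induction over the set \<open>G\<close> of directions on which the cell depends. Where
  \<open>u v \<noteq> 0\<close>, the slice value at \<open>v\<close> is a nonzero affine function of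
  the height and vanishes for at most one height; every other slice is a nonzero cell depending on
  one direction less, so almost all slices of the zero set are null.\<close>

lemma measure_zero_set:
  fixes u :: "'n::finite set \<Rightarrow> real"
  assumes "u v \<noteq> 0"
  shows "measure lborel (cbox 0 1 \<inter> {x. interp u x = 0}) = 0"
proof -
  have "\<forall>u :: 'n set \<Rightarrow> real. (\<forall>v. u v = u (v \<inter> G)) \<longrightarrow> (\<exists>v. u v \<noteq> 0) \<longrightarrow>
      measure lborel (cbox 0 1 \<inter> {x. interp u x = 0}) = 0" for G :: "'n set"
    using finite[of G]
  proof (induction G rule: finite_induct)
    case empty
    show ?case
    proof (intro allI impI)
      fix u :: "'n set \<Rightarrow> real"
      assume const: "\<forall>v. u v = u (v \<inter> {})" and nz: "\<exists>v. u v \<noteq> 0"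
      have "u v = u {}" for v
        using const[rule_format, of v] unfolding Int_empty_right .
      then have "interp u x = u {}" for x
        by (rule interp_const)
      moreover have "u {} \<noteq> 0"
        using const nz by (metis inf_bot_right)
      ultimately show "measure lborel (cbox 0 1 \<inter> {x. interp u x = 0}) = 0"
        by simp
    qed
  next
    case (insert \<gamma> G)
    show ?case
    proof (intro allI impI)
      fix u :: "'n set \<Rightarrow> real"
      assume dep: "\<forall>v. u v = u (v \<inter> insert \<gamma> G)" and "\<exists>v. u v \<noteq> 0"
      then obtain v where v: "u v \<noteq> 0" by blast
      define Z where "Z = {t. slice \<gamma> t u v = 0}"
      have "t = t'" if "t \<in> Z" "t' \<in> Z" for t t'
      proof (rule ccontr)
        assume "t \<noteq> t'"
        have "(t - t') * (u (insert \<gamma> v) - u (v - {\<gamma>})) = 0"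
          using that by (simp add: Z_def slice_def algebra_simps)
        then have "u (insert \<gamma> v) = u (v - {\<gamma>})"
          using \<open>t \<noteq> t'\<close> by simp
        moreover from this have "slice \<gamma> t u v = u (insert \<gamma> v)"
          by (simp add: slice_def left_diff_distrib)
        then have "u (insert \<gamma> v) = 0"
          using that(1) by (simp add: Z_def)
        ultimately show False
          using v by (metis Diff_empty Diff_insert0 insert_absorb)
      qed
      then have "Z \<subseteq> {SOME t. t \<in> Z}"
        by (metis singletonI someI subsetI)
      then have "finite Z"
        using finite_subset by blast
      have "measure lborel (cbox 0 1 \<inter> {x. interp (slice \<gamma> t u) x = 0}) = 0" if "t \<notin> Z" for t
      proof -
        have "slice \<gamma> t u w = slice \<gamma> t u (w \<inter> G)" for w
        proof -
          have "(w - {\<gamma>}) \<inter> insert \<gamma> G = (w \<inter> G - {\<gamma>}) \<inter> insert \<gamma> G"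
              "insert \<gamma> w \<inter> insert \<gamma> G = insert \<gamma> (w \<inter> G) \<inter> insert \<gamma> G"
            by auto
          then have "u (w - {\<gamma>}) = u (w \<inter> G - {\<gamma>})" "u (insert \<gamma> w) = u (insert \<gamma> (w \<inter> G))"
            using dep[rule_format, of "w - {\<gamma>}"] dep[rule_format, of "w \<inter> G - {\<gamma>}"]
              dep[rule_format, of "insert \<gamma> w"] dep[rule_format, of "insert \<gamma> (w \<inter> G)"]
            by (metis, metis)
          then show ?thesis by (simp add: slice_def)
        qed
        moreover have "slice \<gamma> t u v \<noteq> 0"
          using that by (simp add: Z_def)
        ultimately show ?thesis
          using insert.IH by blast
      qed
      then have "((\<lambda>t. measure lborel (cbox 0 1 \<inter> {x. interp (slice \<gamma> t u) x = 0})) has_integral 0) {0..1}"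
        using \<open>finite Z\<close> by (intro has_integral_spike_finite[OF _ _ has_integral_0]) auto
      then show "measure lborel (cbox 0 1 \<inter> {x. interp u x = 0}) = 0"
        using zero_set_slices has_integral_unique by blast
    qed
  qed
  from this[of UNIV] assms show ?thesis by auto
qed

section \<open>Volume of the positive phase\<close>

lemma measure_interp_trichotomy:
  "measure lborel (cbox 0 1 \<inter> {x. 0 < interp u x}) + measure lborel (cbox 0 1 \<inter> {x. interp u x < 0})
    + measure lborel (cbox 0 1 \<inter> {x. interp u x = 0}) = 1"
proof -
  have fin: "emeasure lborel (cbox 0 1 \<inter> B) \<noteq> \<infinity>" if "B \<in> sets borel" for B :: "(real ^ 'a) set"
    using emeasure_unit_cbox_le[OF that] by (auto simp: top_unique)
  define P N Z where PNZ: "P = {x. 0 < interp u x}" "N = {x. interp u x < 0}" "Z = {x. interp u x = 0}"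
  have [measurable]: "P \<in> sets borel" "N \<in> sets borel" "Z \<in> sets borel"
    unfolding PNZ by measurable
  have "1 = measure lborel (cbox 0 (1 :: real ^ 'a))"
    by (simp add: measure_def emeasure_unit_cbox)
  also have "cbox 0 (1 :: real ^ 'a) = (cbox 0 1 \<inter> (P \<union> N)) \<union> (cbox 0 1 \<inter> Z)"
    by (auto simp: PNZ)
  also have "measure lborel \<dots> = measure lborel (cbox 0 1 \<inter> (P \<union> N)) + measure lborel (cbox 0 1 \<inter> Z)"
    by (intro measure_Union fin) (auto simp: PNZ)
  also have "measure lborel (cbox 0 1 \<inter> (P \<union> N)) = measure lborel (cbox 0 1 \<inter> P) + measure lborel (cbox 0 1 \<inter> N)"
    unfolding Int_Un_distrib by (intro measure_Union fin) (auto simp: PNZ)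
  finally show ?thesis
    unfolding PNZ by simp
qed

text \<open>The sign change exchanges the two open phases, whose volumes add up to 1 because the
  interface is null.\<close>

lemma volume_uminus:
  assumes "u v \<noteq> 0"
  shows "phase_volume (\<lambda>v. - u v) = 1 - phase_volume u"
  using measure_interp_trichotomy[of u] measure_zero_set[of u v] assms
  by (simp add: phase_volume_def interp_uminus)

lemma volume_nonpos:
  assumes "\<And>v. u v \<le> 0"
  shows "phase_volume u = 0"
proof -
  have "interp u x \<le> 0" if "x \<in> cbox 0 1" for x
    using multiaffine_nonneg[OF multiaffine_interp, of "\<lambda>v. - u v" x] that assms
    by (simp add: interp_uminus)
  then have "cbox 0 1 \<inter> {x. 0 < interp u x} = {}"
    by force
  then show ?thesis by (simp add: phase_volume_def)
qed

lemma volume_nonneg: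
  assumes "\<And>v. 0 \<le> u v" "u w \<noteq> 0"
  shows "phase_volume u = 1"
  using volume_uminus[of u w] volume_nonpos[of "\<lambda>v. - u v"] assms by simp

text \<open>The source of the integration limits in the formulas: slices beyond the end of the
  origin's edge contain no positive phase.\<close>

lemma volume_slices_support:
  assumes "0 \<le> a" "b \<le> 1"
    and "\<And>t. 0 \<le> t \<Longrightarrow> t \<le> 1 \<Longrightarrow> t < a \<or> b < t \<Longrightarrow> phase_volume (slice \<gamma> t u) = 0"
  shows "((\<lambda>t. phase_volume (slice \<gamma> t u)) has_integral phase_volume u) {a..b}"
proof -
  have "((\<lambda>t. if t \<in> {a..b} then phase_volume (slice \<gamma> t u) else 0) has_integral phase_volume u) {0..1}"
    by (rule has_integral_eq[OF _ volume_slices[of \<gamma> u]]) (use assms in auto)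
  then show ?thesis
    using assms by (subst (asm) has_integral_restrict) auto
qed

lemma has_integral_of_bool_less:
  fixes m :: real
  assumes "0 \<le> m" "m \<le> 1"
  shows "((\<lambda>t. of_bool (t < m)) has_integral m) {0..1}"
    and "((\<lambda>t. of_bool (m < t)) has_integral (1 - m)) {0..1}"
proof -
  have const: "(f has_integral (b - a) * c) {a..b}"
    if "a \<le> b" "\<And>t. a < t \<Longrightarrow> t < b \<Longrightarrow> f t = c" for f and a b c :: real
    using has_integral_spike_finite[of "{a, b}" "{a..b}" f "\<lambda>_. c"] that has_integral_const_real[of c a b]
    by force
  show "((\<lambda>t. of_bool (t < m)) has_integral m) {0..1}"
    using has_integral_combine[OF assms const[of 0 m "\<lambda>t. of_bool (t < m)" 1] const[of m 1 "\<lambda>t. of_bool (t < m)" 0]] assms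
    by simp
  show "((\<lambda>t. of_bool (m < t)) has_integral (1 - m)) {0..1}"
    using has_integral_combine[OF assms const[of 0 m "\<lambda>t. of_bool (m < t)" 0] const[of m 1 "\<lambda>t. of_bool (m < t)" 1]] assms
    by simp
qed

text \<open>The values depend on direction \<zeta> alone, so the cell is effectively a segment with
  value \<open>p\<close> at the end of \<open>i\<close> and \<open>r\<close> at the other. By
  similar triangles its zero has distance \<open>p / (p - r)\<close> from the end of
  \<open>i\<close>.\<close>

lemma volume_segment:
  assumes p: "\<And>v. \<zeta> \<in> v \<longleftrightarrow> \<zeta> \<in> i \<Longrightarrow> u v = p" and r: "\<And>v. \<zeta> \<in> v \<longleftrightarrow> \<zeta> \<notin> i \<Longrightarrow> u v = r"
    and "p > 0" "r \<le> 0"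
  shows "phase_volume u = p / (p - r)"
proof -
  have const: "phase_volume w = of_bool (c > 0)" if "\<And>v. w v = c" for w :: "'a set \<Rightarrow> real" and c
    using volume_nonpos[of w] volume_nonneg[of w] that by (cases "c > 0") auto
  have pr: "0 < p - r"
    using assms(3,4) by simp
  have m: "0 \<le> p / (p - r)" "p / (p - r) \<le> 1"
    using assms(3,4) by (auto simp: field_simps)
  show ?thesis
  proof (cases "\<zeta> \<in> i")
    case True
    have "slice \<zeta> t u v = (1 - t) * r + t * p" for t v
      using True p r by (simp add: slice_def)
    moreover have "0 < (1 - t) * r + t * p \<longleftrightarrow> 1 - p / (p - r) < t" for t
      using pr by (simp add: field_simps)
    ultimately have "phase_volume (slice \<zeta> t u) = of_bool (1 - p / (p - r) < t)" for t
      by (subst const) auto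
    then have "((\<lambda>t. of_bool (1 - p / (p - r) < t)) has_integral phase_volume u) {0..1}"
      using volume_slices[of \<zeta> u] by simp
    then show ?thesis
      using has_integral_unique[OF _ has_integral_of_bool_less(2)[of "1 - p / (p - r)"]] m by simp
  next
    case False
    have "slice \<zeta> t u v = (1 - t) * p + t * r" for t v
      using False p r by (simp add: slice_def)
    moreover have "0 < (1 - t) * p + t * r \<longleftrightarrow> t < p / (p - r)" for t
      using pr by (simp add: field_simps)
    ultimately have "phase_volume (slice \<zeta> t u) = of_bool (t < p / (p - r))" for t
      by (subst const) auto
    then have "((\<lambda>t. of_bool (t < p / (p - r))) has_integral phase_volume u) {0..1}"
      using volume_slices[of \<zeta> u] by simp
    then show ?thesis
      using has_integral_unique[OF _ has_integral_of_bool_less(1)[of "p / (p - r)"]] m by simp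
  qed
qed

text \<open>The common core of both formulas. For \<open>a < t < b\<close> the positive part of the
  \<zeta>-segment at height \<open>t\<close> starts on the \<eta>-edge through \<open>i\<close>, and
  the quotient is its length; outside \<open>{a..b}\<close> it is empty. Dependence on two
  directions makes the result applicable to slices of three-dimensional cells.\<close>

lemma has_integral_volume_corner:
  fixes w :: "'n::finite set \<Rightarrow> real"
  assumes dep: "\<And>v. w v = w (v \<inter> {\<eta>, \<zeta>})" and "\<eta> \<noteq> \<zeta>"
    and ab: "0 \<le> a" "a \<le> b" "b \<le> 1"
    and pos: "\<And>t. a < t \<Longrightarrow> t < b \<Longrightarrow> 0 < slice \<eta> t w i"
    and nonpos: "\<And>t. 0 \<le> t \<Longrightarrow> t \<le> 1 \<Longrightarrow> t < a \<or> b < t \<Longrightarrow> slice \<eta> t w i \<le> 0"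
    and far: "\<And>t. 0 \<le> t \<Longrightarrow> t \<le> 1 \<Longrightarrow> slice \<eta> t w (neighbour \<zeta> i) \<le> 0"
  shows "((\<lambda>t. slice \<eta> t w i / (slice \<eta> t w i - slice \<eta> t w (neighbour \<zeta> i))) has_integral phase_volume w) {a..b}"
proof -
  have slice_dep: "slice \<eta> t w v = slice \<eta> t w v'" if "\<zeta> \<in> v \<longleftrightarrow> \<zeta> \<in> v'" for t v v'
  proof -
    have "(v - {\<eta>}) \<inter> {\<eta>, \<zeta>} = (v' - {\<eta>}) \<inter> {\<eta>, \<zeta>}" "insert \<eta> v \<inter> {\<eta>, \<zeta>} = insert \<eta> v' \<inter> {\<eta>, \<zeta>}"
      using that by auto
    then have "w (v - {\<eta>}) = w (v' - {\<eta>})" "w (insert \<eta> v) = w (insert \<eta> v')"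
      using dep[of "v - {\<eta>}"] dep[of "v' - {\<eta>}"] dep[of "insert \<eta> v"] dep[of "insert \<eta> v'"]
      by (metis, metis)
    then show ?thesis by (simp add: slice_def)
  qed
  have near: "slice \<eta> t w v = slice \<eta> t w i" if "\<zeta> \<in> v \<longleftrightarrow> \<zeta> \<in> i" for t v
    using that by (rule slice_dep)
  have opp: "slice \<eta> t w v = slice \<eta> t w (neighbour \<zeta> i)" if "\<zeta> \<in> v \<longleftrightarrow> \<zeta> \<notin> i" for t v
    using that by (intro slice_dep) (auto simp: neighbour_def)
  have inside: "phase_volume (slice \<eta> t w) = slice \<eta> t w i / (slice \<eta> t w i - slice \<eta> t w (neighbour \<zeta> i))"
    if "a < t" "t < b" for t
    using that ab by (intro volume_segment[where i = i and \<zeta> = \<zeta>] near opp pos far) auto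
  have outside: "phase_volume (slice \<eta> t w) = 0" if "0 \<le> t" "t \<le> 1" "t < a \<or> b < t" for t
    using nonpos[OF that] far[OF that(1,2)] near opp by (intro volume_nonpos) metis
  have "((\<lambda>t. phase_volume (slice \<eta> t w)) has_integral phase_volume w) {a..b}"
    using ab outside by (intro volume_slices_support) auto
  \<comment> \<open>At \<open>a\<close> and \<open>b\<close> the near value may be 0, and the
    denominator with it; these two points are discarded.\<close>
  then show ?thesis
    by (rule has_integral_spike_finite[of "{a, b}", rotated 2]) (use inside in auto)
qed

section \<open>The analytical formulas\<close>

lemma slice_eq_interp: "slice \<gamma> t u v = interp u (set_coord (vertex v) \<gamma> t)"
  by (simp add: interp_set_coord)

text \<open>Unfolds a sum over all subsets one direction at a time, so that \<open>interp\<close>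
  becomes an explicit polynomial in two or three variables.\<close>

lemma sum_Pow_insert:
  assumes "finite A" "a \<notin> A"
  shows "sum f (Pow (insert a A)) = sum f (Pow A) + (\<Sum>B\<in>Pow A. f (insert a B))"
proof -
  have "inj_on (insert a) (Pow A)"
    using assms(2) by (intro inj_onI) (metis Diff_insert_absorb PowD subsetD)
  then show ?thesis
    using assms by (subst Pow_insert, subst sum.union_disjoint) (auto simp: sum.reindex)
qed

lemma interp_2:
  assumes U: "(UNIV :: 'n::finite set) = {\<eta>, \<zeta>}" and ne: "\<eta> \<noteq> \<zeta>"
  shows "interp (u :: 'n set \<Rightarrow> real) x =
    coef u {} + coef u {\<eta>} * x $ \<eta> + (coef u {\<zeta>} + coef u {\<eta>, \<zeta>} * x $ \<eta>) * x $ \<zeta>"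
  unfolding interp_def Pow_UNIV[symmetric] U using ne
  by (simp add: sum_Pow_insert algebra_simps)

lemma interp_3:
  assumes U: "(UNIV :: 'n::finite set) = {\<xi>, \<eta>, \<zeta>}" and ne: "\<xi> \<noteq> \<eta>" "\<xi> \<noteq> \<zeta>" "\<eta> \<noteq> \<zeta>"
  shows "interp (u :: 'n set \<Rightarrow> real) x =
    coef u {} + coef u {\<xi>} * x $ \<xi> + (coef u {\<eta>} + coef u {\<xi>, \<eta>} * x $ \<xi>) * x $ \<eta> +
    (coef u {\<zeta>} + coef u {\<xi>, \<zeta>} * x $ \<xi> + (coef u {\<eta>, \<zeta>} + coef u {\<xi>, \<eta>, \<zeta>} * x $ \<xi>) * x $ \<eta>)
      * x $ \<zeta>"
  unfolding interp_def Pow_UNIV[symmetric] U using ne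
  by (simp add: sum_Pow_insert algebra_simps)

section \<open>Signs and zeros on the edges at the origin\<close>

lemma slice_nonpos:
  "0 \<le> t \<Longrightarrow> t \<le> 1 \<Longrightarrow> u (v - {\<gamma>}) \<le> 0 \<Longrightarrow> u (insert \<gamma> v) \<le> 0 \<Longrightarrow> slice \<gamma> t u v \<le> 0"
  unfolding slice_def by (intro add_nonpos_nonpos mult_nonneg_nonpos) auto

text \<open>With \<open>p\<close> and \<open>r\<close> the values at coordinate 0 and 1, opposite
  signs make the zero unique and equal to \<open>p / (p - r)\<close>, so the description by
  \<open>THE\<close> is well defined.\<close>

lemma edge_end_opposite:
  assumes "opposite u i \<gamma>"
  shows "0 < edge_end u i \<gamma>" "edge_end u i \<gamma> < 1" "slice \<gamma> (edge_end u i \<gamma>) u i = 0"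
proof -
  define p where "p = u (i - {\<gamma>})"
  define r where "r = u (insert \<gamma> i)"
  have pr: "p * r < 0"
    using assms by (auto simp: opposite_def neighbour_def p_def r_def insert_absorb mult.commute split: if_splits)
  then have sgn: "p < 0 \<and> 0 < r \<or> r < 0 \<and> 0 < p"
    by (auto simp: mult_less_0_iff)
  have slice: "slice \<gamma> t u i = 0 \<longleftrightarrow> t = p / (p - r)" for t
    using sgn by (auto simp: slice_def p_def[symmetric] r_def[symmetric] field_simps)
  have m: "0 < p / (p - r)" "p / (p - r) < 1"
    using sgn by (auto simp: field_simps zero_less_divide_iff)
  have *: "(\<chi> \<delta>. if \<delta> = \<gamma> then t else vcoord i \<delta>) = set_coord (vertex i) \<gamma> t" for t
    by (simp add: vec_eq_iff vcoord_def)
  have "edge_end u i \<gamma> = (THE t. 0 \<le> t \<and> t \<le> 1 \<and> t = p / (p - r))"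
    using assms by (simp add: edge_end_def * slice_eq_interp[symmetric] slice)
  also have "\<dots> = p / (p - r)"
    using m by (intro the_equality) auto
  finally have e: "edge_end u i \<gamma> = p / (p - r)" .
  show "0 < edge_end u i \<gamma>" "edge_end u i \<gamma> < 1" "slice \<gamma> (edge_end u i \<gamma>) u i = 0"
    using m by (simp_all add: e slice)
qed

text \<open>The zero lies strictly inside the edge, whereas an uncut edge has length 1. Comparing
  edge lengths therefore reveals which edges at the origin are cut.\<close>

lemma edge_length_opposite: "opposite u i \<gamma> \<Longrightarrow> edge_length u i \<gamma> < 1"
  using edge_end_opposite[of u i \<gamma>] by (auto simp: edge_length_def vcoord_def)

lemma edge_length_not_opposite: "\<not> opposite u i \<gamma> \<Longrightarrow> edge_length u i \<gamma> = 1"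
  by (simp add: edge_length_def edge_end_def vcoord_def)

text \<open>Positivity is limited to the open interval because its end away from the origin is the
  zero of a cut edge or, on an uncut edge, a vertex whose value may be 0.\<close>

lemma edge_sign:
  fixes u :: "'n::finite set \<Rightarrow> real" and \<gamma> :: 'n
  assumes "u i > 0"
  defines "a \<equiv> min (edge_end u i \<gamma>) (vcoord i \<gamma>)" and "b \<equiv> max (edge_end u i \<gamma>) (vcoord i \<gamma>)"
  shows "0 \<le> a" "a \<le> b" "b \<le> 1"
    and "\<And>t. a < t \<Longrightarrow> t < b \<Longrightarrow> 0 < slice \<gamma> t u i"
    and "\<And>t. 0 \<le> t \<Longrightarrow> t \<le> 1 \<Longrightarrow> t < a \<or> b < t \<Longrightarrow> slice \<gamma> t u i \<le> 0"
proof -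
  consider (opp) "opposite u i \<gamma>" | (same) "\<not> opposite u i \<gamma>" by blast
  then have "0 \<le> a \<and> a \<le> b \<and> b \<le> 1 \<and> (\<forall>t. a < t \<longrightarrow> t < b \<longrightarrow> 0 < slice \<gamma> t u i) \<and>
    (\<forall>t. 0 \<le> t \<longrightarrow> t \<le> 1 \<longrightarrow> t < a \<or> b < t \<longrightarrow> slice \<gamma> t u i \<le> 0)"
  proof cases
    case opp
    define e where "e = edge_end u i \<gamma>"
    have e: "0 < e" "e < 1" "slice \<gamma> e u i = 0"
      using edge_end_opposite[OF opp] by (simp_all add: e_def)
    define d where "d = u (insert \<gamma> i) - u (i - {\<gamma>})"
    have slice: "slice \<gamma> t u i = (t - e) * d" for t
      using e(3) by (simp add: slice_def d_def algebra_simps)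
    show ?thesis
    proof (cases "\<gamma> \<in> i")
      case True
      then have ab: "a = e" "b = 1"
        using e by (simp_all add: a_def b_def e_def vcoord_def)
      have "d > 0"
        using opp assms(1) True
        by (simp add: d_def opposite_def neighbour_def insert_absorb mult_less_0_iff)
      then show ?thesis
        using e by (auto simp: ab slice mult_le_0_iff)
    next
      case False
      then have ab: "a = 0" "b = e"
        using e by (simp_all add: a_def b_def e_def vcoord_def)
      have "d < 0"
        using opp assms(1) False
        by (simp add: d_def opposite_def neighbour_def mult_less_0_iff)
      then show ?thesis
        using e by (auto simp: ab slice mult_le_0_iff zero_less_mult_iff)
    qed
  next
    case same
    then have ab: "a = 0" "b = 1"
      by (auto simp: a_def b_def edge_end_def vcoord_def)
    have "u (neighbour \<gamma> i) \<ge> 0"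
      using same assms(1) by (simp add: opposite_def mult_less_0_iff)
    then have "0 < slice \<gamma> t u i" if "0 < t" "t < 1" for t
      using that assms(1)
      by (cases "\<gamma> \<in> i")
         (simp_all add: slice_def neighbour_def insert_absorb add_pos_nonneg add_nonneg_pos)
    then show ?thesis
      by (auto simp: ab)
  qed
  then show "0 \<le> a" "a \<le> b" "b \<le> 1" "\<And>t. a < t \<Longrightarrow> t < b \<Longrightarrow> 0 < slice \<gamma> t u i"
    "\<And>t. 0 \<le> t \<Longrightarrow> t \<le> 1 \<Longrightarrow> t < a \<or> b < t \<Longrightarrow> slice \<gamma> t u i \<le> 0"
    by blast+
qed

text \<open>\<open>- A / B\<close> is the \<zeta>-coordinate of the zero of
  \<open>A + B * \<zeta>\<close>, while \<open>p / (p - r)\<close> is its distance from the end with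
  coordinate \<open>k\<close>. Converting one into the other produces the factor
  \<open>1 - 2 * k\<close> and the summand \<open>k\<close> of the formulas.\<close>

lemma zero_on_segment_eq_fraction:
  fixes A B k p r :: real
  assumes "k = 0 \<or> k = 1" "p = A + k * B" "r = A + (1 - k) * B" "p > 0" "r \<le> 0"
  shows "- A / B = (1 - 2 * k) * (p / (p - r) - k)"
proof -
  have "B \<noteq> 0" using assms by auto
  then show ?thesis
    using assms(1) by (elim disjE) (simp_all add: assms(2,3) field_simps)
qed

section \<open>The cut-volume formulas for a positive origin\<close>

lemma vcoord_01: "vcoord v \<gamma> = 0 \<or> vcoord v \<gamma> = 1"
  by (simp add: vcoord_def)

lemma vcoord_neighbour: "vcoord (neighbour \<gamma> v) \<delta> = (if \<delta> = \<gamma> then 1 - vcoord v \<delta> else vcoord v \<delta>)"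
  by (simp add: vcoord_def neighbour_def)

text \<open>By \<open>far\<close> the side of the square opposite to the origin's \<eta>-edge
  carries no positive vertex, so the positive phase is the region between that edge and the graph of
  the interface over it.\<close>

lemma cut_volume_2_pos:
  fixes u :: "'n::finite set \<Rightarrow> real"
  assumes U: "(UNIV :: 'n set) = {\<eta>, \<zeta>}" and ne: "\<eta> \<noteq> \<zeta>" and i: "u i > 0"
    and far: "\<And>v. \<zeta> \<in> v \<longleftrightarrow> \<zeta> \<notin> i \<Longrightarrow> u v \<le> 0"
  shows "cut_volume_2 u i \<eta> \<zeta> = phase_volume u"
proof -
  define a where "a = min (edge_end u i \<eta>) (vcoord i \<eta>)"
  define b where "b = max (edge_end u i \<eta>) (vcoord i \<eta>)"
  define k where "k = vcoord i \<zeta>"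
  define z where "z t = - (coef u {\<eta>} * t + coef u {}) / (coef u {\<eta>, \<zeta>} * t + coef u {\<zeta>})" for t
  define p r where "p t = slice \<eta> t u i" and "r t = slice \<eta> t u (neighbour \<zeta> i)" for t
  note edge = edge_sign[where u = u and i = i and \<gamma> = \<eta>, OF i, folded a_def b_def p_def]
  have far': "r t \<le> 0" if "0 \<le> t" "t \<le> 1" for t
    unfolding r_def by (intro slice_nonpos that far) (use ne in \<open>auto simp: neighbour_def\<close>)
  have vol: "((\<lambda>t. p t / (p t - r t)) has_integral phase_volume u) {a..b}"
    unfolding p_def r_def
    by (rule has_integral_volume_corner)
       (use edge far' ne in \<open>auto simp: U[symmetric] p_def r_def\<close>)
  have k: "k = 0 \<or> k = 1"
    by (simp add: k_def vcoord_01)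
  have z: "z t = (1 - 2 * k) * (p t / (p t - r t) - k)" if "a < t" "t < b" for t
    unfolding z_def
  proof (rule zero_on_segment_eq_fraction[OF k])
    show "p t = coef u {\<eta>} * t + coef u {} + k * (coef u {\<eta>, \<zeta>} * t + coef u {\<zeta>})"
      "r t = coef u {\<eta>} * t + coef u {} + (1 - k) * (coef u {\<eta>, \<zeta>} * t + coef u {\<zeta>})"
      using ne by (simp_all add: p_def r_def k_def slice_eq_interp interp_2[OF U ne] vertex_def vcoord_neighbour algebra_simps
          flip: vcoord_def)
    show "0 < p t" "r t \<le> 0"
      using that edge far' by auto
  qed
  have "((\<lambda>t. (1 - 2 * k) * (p t / (p t - r t) - k)) has_integral (1 - 2 * k) * (phase_volume u - k * (b - a))) {a..b}"
    using has_integral_const_real[of k a b] edge(2)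
    by (intro has_integral_mult_right has_integral_diff[OF vol]) (simp add: mult.commute)
  then have "(z has_integral (1 - 2 * k) * (phase_volume u - k * (b - a))) {a..b}"
    by (rule has_integral_spike_finite[of "{a, b}", rotated 2]) (use z in auto)
  then have "integral {a..b} z = (1 - 2 * k) * (phase_volume u - k * (b - a))"
    by (rule integral_unique)
  \<comment> \<open>Since \<open>k\<close> is 0 or 1, the square of \<open>1 - 2 * k\<close> is 1
    and the two terms with \<open>k * (b - a)\<close> cancel.\<close>
  then have "cut_volume_2 u i \<eta> \<zeta> = (1 - 2 * k) * ((1 - 2 * k) * (phase_volume u - k * (b - a))) + k * (b - a)"
    unfolding cut_volume_2_def Let_def a_def[symmetric] b_def[symmetric] k_def[symmetric] z_def[symmetric]
    by simp
  then show ?thesis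
    using k by auto
qed

text \<open>Positive vertices occur only on the \<xi>-edge through \<open>i\<close>, so for
  \<open>a < s < b\<close> the slice at \<xi>-coordinate \<open>s\<close> is a planar cell with one
  positive corner. Its area is found as in the plane, with limits moving with
  \<open>s\<close>.\<close>

lemma cut_volume_3_pos:
  fixes u :: "'n::finite set \<Rightarrow> real"
  assumes U: "(UNIV :: 'n set) = {\<xi>, \<eta>, \<zeta>}" and ne: "\<xi> \<noteq> \<eta>" "\<xi> \<noteq> \<zeta>" "\<eta> \<noteq> \<zeta>"
    and i: "u i > 0" and far: "\<And>v. v \<noteq> i \<Longrightarrow> v \<noteq> neighbour \<xi> i \<Longrightarrow> u v \<le> 0"
  shows "cut_volume_3 u i \<xi> \<eta> \<zeta> = phase_volume u"
proof -
  define a where "a = min (edge_end u i \<xi>) (vcoord i \<xi>)"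
  define b where "b = max (edge_end u i \<xi>) (vcoord i \<xi>)"
  define k where "k = vcoord i \<zeta>"
  note edge = edge_sign[where u = u and i = i and \<gamma> = \<xi>, OF i, folded a_def b_def]
  have k: "k = 0 \<or> k = 1"
    by (simp add: k_def vcoord_01)
  define q where "q = (\<lambda>s. - ((coef u {\<xi>, \<zeta>} * k + coef u {\<xi>}) * s + coef u {\<zeta>} * k + coef u {}) /
    ((coef u {\<xi>, \<eta>, \<zeta>} * k + coef u {\<xi>, \<eta>}) * s + coef u {\<eta>, \<zeta>} * k + coef u {\<eta>}))"
  define \<eta>0 where "\<eta>0 = (\<lambda>s. if \<eta> \<in> i then q s else 0)"
  define \<eta>1 where "\<eta>1 = (\<lambda>s. if \<eta> \<in> i then 1 else q s)"
  define z where "z = (\<lambda>s t. (- s * (coef u {\<xi>, \<eta>} * t + coef u {\<xi>}) - coef u {\<eta>} * t - coef u {}) /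
    (s * (coef u {\<xi>, \<eta>, \<zeta>} * t + coef u {\<xi>, \<zeta>}) + coef u {\<eta>, \<zeta>} * t + coef u {\<zeta>}))"
  \<comment> \<open>The face \<open>\<zeta> = i\<^sub>\<zeta>\<close>: the length \<open>\<eta>\<^sub>1 - \<eta>\<^sub>0\<close> is the phase volume of its slices, hence integrable.\<close>
  define face where "face v = u (if \<zeta> \<in> i then insert \<zeta> v else v - {\<zeta>})" for v
  have slice_cong: "slice \<xi> s u v = slice \<xi> s u v'" if "v - {\<xi>} = v' - {\<xi>}" for s v v'
    using that by (metis insert_Diff_single slice_def)
  \<comment> \<open>Slicing merges the two ends of the \<xi>-edge through \<open>i\<close> into one
    corner; every other corner averages two nonpositive vertex values.\<close>
  have slice_far: "slice \<xi> s u v \<le> 0" if "0 \<le> s" "s \<le> 1" "v - {\<xi>} \<noteq> i - {\<xi>}" for s v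
  proof -
    have "v - {\<xi>} \<noteq> i" "v - {\<xi>} \<noteq> neighbour \<xi> i" "insert \<xi> v \<noteq> i" "insert \<xi> v \<noteq> neighbour \<xi> i"
      using that(3) by (auto simp: neighbour_def)
    then show ?thesis
      using that(1,2) by (intro slice_nonpos far)
  qed
  have inner: "0 \<le> \<eta>0 s" "\<eta>0 s \<le> \<eta>1 s" "\<eta>1 s \<le> 1"
      "integral {\<eta>0 s..\<eta>1 s} (z s) = (1 - 2 * k) * (phase_volume (slice \<xi> s u) - k * (\<eta>1 s - \<eta>0 s))"
      "\<eta>1 s - \<eta>0 s = phase_volume (slice \<xi> s face)"
    if s: "a < s" "s < b" for s
  proof -
    define w where "w = slice \<xi> s u"
    have s01: "0 \<le> s" "s \<le> 1"
      using s edge by auto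
    have wi: "w i > 0"
      using s edge(4) by (simp add: w_def)
    have w_far: "w v \<le> 0" if "v - {\<xi>} \<noteq> i - {\<xi>}" for v
      using slice_far[OF s01 that] by (simp add: w_def)
    define p r where "p t = slice \<eta> t w i" and "r t = slice \<eta> t w (neighbour \<zeta> i)" for t
    define B where "B = w (i - {\<eta>})"
    define A where "A = w (insert \<eta> i) - w (i - {\<eta>})"
    have p: "p t = A * t + B" for t
      by (simp add: p_def slice_def A_def B_def algebra_simps)
    have AB: "A = (coef u {\<xi>, \<eta>, \<zeta>} * k + coef u {\<xi>, \<eta>}) * s + coef u {\<eta>, \<zeta>} * k + coef u {\<eta>}"
        "B = (coef u {\<xi>, \<zeta>} * k + coef u {\<xi>}) * s + coef u {\<zeta>} * k + coef u {}"
      using ne by (simp_all add: A_def B_def w_def slice_eq_interp interp_3[OF U ne] vertex_def k_def vcoord_def algebra_simps)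
    have q: "q s = - B / A"
      by (simp add: q_def AB)
    have far_r: "r t \<le> 0" if "0 \<le> t" "t \<le> 1" for t
    proof -
      have "\<zeta> \<in> i - {\<xi>} \<longleftrightarrow> \<zeta> \<notin> neighbour \<zeta> i - {\<eta>} - {\<xi>}" "\<zeta> \<in> i - {\<xi>} \<longleftrightarrow> \<zeta> \<notin> insert \<eta> (neighbour \<zeta> i) - {\<xi>}"
        using ne by (auto simp: neighbour_def)
      then have "w (neighbour \<zeta> i - {\<eta>}) \<le> 0" "w (insert \<eta> (neighbour \<zeta> i)) \<le> 0"
        by (intro w_far; metis)+
      then show ?thesis
        unfolding r_def using that by (intro slice_nonpos)
    qed
    \<comment> \<open>Along the \<eta>-edge through \<open>i\<close> the slice value
      \<open>p\<close> is affine, positive at \<open>i\<close> and nonpositive at the other end.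
      This fixes the sign of the slope \<open>A\<close> and places the zero \<open>q s\<close> in
      the unit interval.\<close>
    have A: "0 \<le> \<eta>0 s \<and> \<eta>0 s \<le> \<eta>1 s \<and> \<eta>1 s \<le> 1 \<and> (\<forall>t. \<eta>0 s < t \<longrightarrow> t < \<eta>1 s \<longrightarrow> 0 < p t) \<and>
      (\<forall>t. 0 \<le> t \<longrightarrow> t \<le> 1 \<longrightarrow> t < \<eta>0 s \<or> \<eta>1 s < t \<longrightarrow> p t \<le> 0) \<and>
      \<eta>1 s - \<eta>0 s = w i / (w i - w (neighbour \<eta> i))"
    proof (cases "\<eta> \<in> i")
      case True
      have "B \<le> 0"
        unfolding B_def using True ne by (intro w_far) auto
      moreover have AB_pos: "A + B = w i"
        using True by (simp add: A_def B_def insert_absorb)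
      ultimately have Apos: "0 < A"
        using wi by simp
      have pq: "p t = A * (t - q s)" for t
        using Apos by (simp add: p q field_simps)
      have "0 \<le> q s" "q s \<le> 1"
        using Apos \<open>B \<le> 0\<close> AB_pos wi by (auto simp: q field_simps)
      moreover have "1 - q s = w i / (w i - w (neighbour \<eta> i))"
        using Apos True AB_pos by (simp add: q neighbour_def B_def[symmetric] field_simps)
      ultimately show ?thesis
        using True Apos by (auto simp: \<eta>0_def \<eta>1_def pq mult_le_0_iff)
    next
      case False
      have "A + B \<le> 0"
        unfolding A_def B_def using False ne by (simp, intro w_far) auto
      moreover have Bi: "B = w i"
        using False by (simp add: B_def)
      ultimately have Aneg: "A < 0"
        using wi by simp
      have pq: "p t = A * (t - q s)" for t
        using Aneg by (simp add: p q field_simps)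
      have "0 \<le> q s" "q s \<le> 1"
        using Aneg \<open>A + B \<le> 0\<close> Bi wi by (auto simp: q field_simps)
      moreover have "q s = w i / (w i - w (neighbour \<eta> i))"
        using Aneg False by (simp add: q neighbour_def A_def Bi field_simps)
      ultimately show ?thesis
        using False Aneg by (auto simp: \<eta>0_def \<eta>1_def pq mult_le_0_iff zero_less_mult_iff)
    qed
    then show \<eta>01: "0 \<le> \<eta>0 s" "\<eta>0 s \<le> \<eta>1 s" "\<eta>1 s \<le> 1"
      by auto
    have "((\<lambda>t. p t / (p t - r t)) has_integral phase_volume w) {\<eta>0 s..\<eta>1 s}"
      unfolding p_def r_def
    proof (rule has_integral_volume_corner[OF _ ne(3) \<eta>01])
      show "w v = w (v \<inter> {\<eta>, \<zeta>})" for v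
        unfolding w_def using U by (intro slice_cong) blast
    qed (use A far_r in \<open>auto simp: p_def r_def\<close>)
    then have "((\<lambda>t. (1 - 2 * k) * (p t / (p t - r t) - k)) has_integral
        (1 - 2 * k) * (phase_volume w - k * (\<eta>1 s - \<eta>0 s))) {\<eta>0 s..\<eta>1 s}"
      using has_integral_const_real[of k "\<eta>0 s" "\<eta>1 s"] \<eta>01
      by (intro has_integral_mult_right has_integral_diff) (auto simp: mult.commute)
    moreover have "z s t = (1 - 2 * k) * (p t / (p t - r t) - k)" if t: "\<eta>0 s < t" "t < \<eta>1 s" for t
    proof -
      define C where "C = s * (coef u {\<xi>, \<eta>} * t + coef u {\<xi>}) + coef u {\<eta>} * t + coef u {}"
      define D where "D = s * (coef u {\<xi>, \<eta>, \<zeta>} * t + coef u {\<xi>, \<zeta>}) + coef u {\<eta>, \<zeta>} * t + coef u {\<zeta>}"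
      have "z s t = - C / D"
        by (simp add: z_def C_def D_def)
      also have "\<dots> = (1 - 2 * k) * (p t / (p t - r t) - k)"
      proof (rule zero_on_segment_eq_fraction[OF k])
        \<comment> \<open>Two successive slicings amount to one evaluation of the interpolant of
          \<open>u\<close> at \<xi>-coordinate \<open>s\<close> and \<eta>-coordinate
          \<open>t\<close>, so the explicit polynomial applies.\<close>
        have pr: "p t = interp u (set_coord (set_coord (vertex i) \<eta> t) \<xi> s)"
            "r t = interp u (set_coord (set_coord (vertex (neighbour \<zeta> i)) \<eta> t) \<xi> s)"
          by (simp_all add: p_def r_def w_def slice_eq_interp interp_set_coord[symmetric] del: interp_vertex)
        show "p t = C + k * D" "r t = C + (1 - k) * D"
          unfolding pr interp_3[OF U ne]
          using ne by (simp_all add: C_def D_def vertex_def vcoord_neighbour k_def[symmetric] algebra_simps)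
        show "0 < p t" "r t \<le> 0"
          using A t far_r[of t] by auto
      qed
      finally show ?thesis .
    qed
    ultimately have "(z s has_integral (1 - 2 * k) * (phase_volume w - k * (\<eta>1 s - \<eta>0 s))) {\<eta>0 s..\<eta>1 s}"
      by (intro has_integral_spike_finite[of "{\<eta>0 s, \<eta>1 s}" "{\<eta>0 s..\<eta>1 s}" "z s"
            "\<lambda>t. (1 - 2 * k) * (p t / (p t - r t) - k)"]) auto
    then show "integral {\<eta>0 s..\<eta>1 s} (z s) = (1 - 2 * k) * (phase_volume (slice \<xi> s u) - k * (\<eta>1 s - \<eta>0 s))"
      unfolding w_def by (rule integral_unique)
    have face: "slice \<xi> s face v = w (if \<zeta> \<in> i then insert \<zeta> v else v - {\<zeta>})" for v
      using ne by (auto simp: face_def w_def slice_def insert_commute insert_Diff_if Diff_insert2[symmetric] intro!: arg_cong2[where f = "(+)"] arg_cong[where f = u])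
    \<comment> \<open>The slice of the face varies in direction \<eta> only, so its volume is the
      length of the positive segment on the \<eta>-edge through \<open>i\<close>.\<close>
    have "phase_volume (slice \<xi> s face) = w i / (w i - w (neighbour \<eta> i))"
    proof (rule volume_segment[where \<zeta> = \<eta> and i = i])
      show "slice \<xi> s face v = w i" if "\<eta> \<in> v \<longleftrightarrow> \<eta> \<in> i" for v
        unfolding face unfolding w_def using U that ne by (intro slice_cong) auto
      show "slice \<xi> s face v = w (neighbour \<eta> i)" if "\<eta> \<in> v \<longleftrightarrow> \<eta> \<notin> i" for v
        unfolding face unfolding w_def neighbour_def using U that ne by (intro slice_cong) auto
      show "w (neighbour \<eta> i) \<le> 0"
        using ne by (intro w_far) (auto simp: neighbour_def)
    qed (fact wi)
    then show "\<eta>1 s - \<eta>0 s = phase_volume (slice \<xi> s face)"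
      using A by simp
  qed
  have vol: "((\<lambda>s. phase_volume (slice \<xi> s u)) has_integral phase_volume u) {a..b}"
  proof (rule volume_slices_support)
    fix s assume s: "0 \<le> s" "s \<le> 1" "s < a \<or> b < s"
    have "slice \<xi> s u v \<le> 0" for v
    proof (cases "v - {\<xi>} = i - {\<xi>}")
      case True
      then show ?thesis using edge(5)[OF s] slice_cong by metis
    qed (use slice_far s in auto)
    then show "phase_volume (slice \<xi> s u) = 0"
      by (rule volume_nonpos)
  qed (use edge in auto)
  \<comment> \<open>What counts is that the integral \<open>L\<close> exists; it cancels at the end,
    again because \<open>1 - 2 * k\<close> has square 1.\<close>
  obtain L where L: "((\<lambda>s. phase_volume (slice \<xi> s face)) has_integral L) {a..b}"
    using integrable_on_subinterval[OF has_integral_integrable[OF volume_slices[of \<xi> face]], of a b] edge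
    by auto
  have "((\<lambda>s. \<eta>1 s - \<eta>0 s) has_integral L) {a..b}"
    by (rule has_integral_spike_finite[of "{a, b}", OF _ _ L]) (use inner(5) in auto)
  moreover have "((\<lambda>s. (1 - 2 * k) * (phase_volume (slice \<xi> s u) - k * phase_volume (slice \<xi> s face))) has_integral
      (1 - 2 * k) * (phase_volume u - k * L)) {a..b}"
    by (intro has_integral_mult_right has_integral_diff vol L)
  then have "((\<lambda>s. integral {\<eta>0 s..\<eta>1 s} (z s)) has_integral (1 - 2 * k) * (phase_volume u - k * L)) {a..b}"
    by (rule has_integral_spike_finite[of "{a, b}", rotated 2]) (use inner(4,5) in auto)
  moreover have "cut_volume_3 u i \<xi> \<eta> \<zeta> = (1 - 2 * k) * integral {a..b} (\<lambda>s. integral {\<eta>0 s..\<eta>1 s} (z s))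
      + k * integral {a..b} (\<lambda>s. \<eta>1 s - \<eta>0 s)"
    unfolding cut_volume_3_def Let_def a_def b_def k_def q_def \<eta>0_def \<eta>1_def z_def ..
  ultimately have "cut_volume_3 u i \<xi> \<eta> \<zeta> = (1 - 2 * k) * ((1 - 2 * k) * (phase_volume u - k * L)) + k * L"
    by (simp only: integral_unique)
  then show ?thesis
    using k by auto
qed

section \<open>Exactness of the phase_volume fractions\<close>

lemma coef_uminus: "coef (\<lambda>v. - u v) S = - coef u S"
  by (simp add: coef_def sum_negf)

lemma opposite_uminus: "opposite (\<lambda>v. - u v) = opposite u"
  by (simp add: opposite_def fun_eq_iff)

lemma edge_end_uminus: "edge_end (\<lambda>v. - u v) = edge_end u"
  by (simp add: edge_end_def fun_eq_iff opposite_uminus interp_uminus)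

lemma edge_length_uminus: "edge_length (\<lambda>v. - u v) = edge_length u"
  by (simp add: edge_length_def fun_eq_iff edge_end_uminus)

lemma is_origin_uminus: "is_origin (\<lambda>v. - u v) = is_origin u"
  by (simp add: is_origin_def fun_eq_iff opposite_uminus)

lemma cut_cell_uminus: "cut_cell (\<lambda>v. - u v) = cut_cell u"
  by (auto simp: cut_cell_def)

text \<open>Numerator and denominator of the interface function both change sign, and the edge ends
  are zeros, which stay in place.\<close>

lemma cut_volume_2_uminus: "cut_volume_2 (\<lambda>v. - u v) i \<eta> \<zeta> = cut_volume_2 u i \<eta> \<zeta>"
proof -
  have "- (- a * t + - b) / (- c * t + - d) = - (a * t + b) / (c * t + d)" for a b c d t :: real
    using minus_divide_divide[of "- (a * t + b)" "c * t + d"] by (simp add: algebra_simps)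
  then show ?thesis
    unfolding cut_volume_2_def Let_def coef_uminus edge_end_uminus by presburger
qed

lemma cut_volume_3_uminus: "cut_volume_3 (\<lambda>v. - u v) i \<xi> \<eta> \<zeta> = cut_volume_3 u i \<xi> \<eta> \<zeta>"
proof -
  have z: "(- s * (- a * t + - b) - - c * t - - d) / (s * (- e * t + - f) + - g * t + - h) =
      (- s * (a * t + b) - c * t - d) / (s * (e * t + f) + g * t + h)" for a b c d e f g h s t :: real
    using minus_divide_divide[of "- s * (a * t + b) - c * t - d" "s * (e * t + f) + g * t + h"]
    by (simp add: algebra_simps)
  have q: "- ((- f * k + - b) * s + - h * k + - d) / ((- e * k + - a) * s + - g * k + - c) =
      - ((f * k + b) * s + h * k + d) / ((e * k + a) * s + g * k + c)" for a b c d e f g h s k :: real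
    using minus_divide_divide[of "- ((f * k + b) * s + h * k + d)" "(e * k + a) * s + g * k + c"]
    by (simp add: algebra_simps)
  show ?thesis
    unfolding cut_volume_3_def Let_def coef_uminus edge_end_uminus z q ..
qed

text \<open>Reduces both signs of the origin to the positive case: a formula value that is exact for
  \<open>-u\<close> on the negative side is turned into its complement by
  \<open>positive_part\<close>.\<close>

lemma positive_part_eq_volume:
  assumes i: "u i \<noteq> 0" and V: "u i > 0 \<Longrightarrow> V = phase_volume u" "u i < 0 \<Longrightarrow> V = phase_volume (\<lambda>v. - u v)"
  shows "positive_part u i V = phase_volume u"
  using V volume_uminus[of u i, OF i] i by (auto simp: positive_part_def)

section \<open>Sign patterns of resolved planar cells and exact cell fractions\<close>

lemma two_directions:
  assumes "CARD('n::finite) = 2" "\<eta> \<noteq> \<zeta>"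
  shows "(UNIV :: 'n set) = {\<eta>, \<zeta>}"
  using assms by (intro card_subset_eq[symmetric]) auto

lemma three_directions:
  assumes "CARD('n::finite) = 3" "\<xi> \<noteq> \<eta>" "\<xi> \<noteq> \<zeta>" "\<eta> \<noteq> \<zeta>"
  shows "(UNIV :: 'n set) = {\<xi>, \<eta>, \<zeta>}"
  using assms by (intro card_subset_eq[symmetric]) auto

lemma neighbour_neighbour [simp]: "neighbour \<gamma> (neighbour \<gamma> v) = v"
  by (auto simp: neighbour_def)

lemma neighbour_commute: "neighbour \<gamma> (neighbour \<delta> v) = neighbour \<delta> (neighbour \<gamma> v)"
  by (auto simp: neighbour_def)

text \<open>\<open>A\<close>, \<open>B\<close> and \<open>D\<close> are the \<eta>-neighbour, the
  \<zeta>-neighbour and the diagonal vertex; the claim concerns \<open>B\<close> and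
  \<open>D\<close>. If \<open>B\<close> were positive, no edge at the origin would be cut and
  \<open>D\<close> would be negative, so \<open>B\<close> would have more cut edges than the origin.
  If \<open>D\<close> were positive and \<open>B\<close> negative, \<open>B\<close> would have two
  cut edges, hence so would the origin, which is the ambiguous pattern; with \<open>B\<close>
  nonnegative there would be no negative vertex.\<close>

lemma resolved_far_side:
  fixes u :: "'n::finite set \<Rightarrow> real"
  assumes card: "CARD('n) = 2" and ne: "\<eta> \<noteq> \<zeta>"
    and cut: "cut_cell u" and origin: "is_origin u i" and len: "edge_length u i \<zeta> \<le> edge_length u i \<eta>"
    and resolved: "\<not> (\<forall>v \<gamma>. opposite u v \<gamma>)"
    and i: "u i > 0" and v: "\<zeta> \<in> v \<longleftrightarrow> \<zeta> \<notin> i"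
  shows "u v \<le> 0"
proof -
  have U: "UNIV = {\<eta>, \<zeta>}"
    by (rule two_directions[OF card ne])
  have dir: "\<gamma> = \<eta> \<or> \<gamma> = \<zeta>" for \<gamma>
    using U by (metis UNIV_I insertE singletonD)
  define A B D where "A = neighbour \<eta> i" and "B = neighbour \<zeta> i" and "D = neighbour \<eta> B"
  note ABD = A_def B_def D_def
  have vertices: "w = i \<or> w = A \<or> w = B \<or> w = D" for w
  proof -
    have "w = w'" if "\<eta> \<in> w \<longleftrightarrow> \<eta> \<in> w'" "\<zeta> \<in> w \<longleftrightarrow> \<zeta> \<in> w'" for w' :: "'n set"
      using that dir by (intro set_eqI) metis
    note eq = this
    have mem: "\<gamma> \<in> neighbour \<delta> x \<longleftrightarrow> (if \<gamma> = \<delta> then \<gamma> \<notin> x else \<gamma> \<in> x)" for \<gamma> \<delta> and x :: "'n set"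
      by (auto simp: neighbour_def)
    show ?thesis
      using eq[of i] eq[of A] eq[of B] eq[of D] ne unfolding ABD mem by metis
  qed
  have opp_count: "card {\<gamma>. opposite u w \<gamma>} = of_bool (opposite u w \<eta>) + of_bool (opposite u w \<zeta>)" for w
  proof -
    have "{\<gamma>. opposite u w \<gamma>} = {\<gamma>\<in>{\<eta>, \<zeta>}. opposite u w \<gamma>}"
      using dir by auto
    also have "\<dots> = (if opposite u w \<eta> then {\<eta>} else {}) \<union> (if opposite u w \<zeta> then {\<zeta>} else {})"
      by auto
    finally show ?thesis using ne by auto
  qed
  have nb: "neighbour \<eta> i = A" "neighbour \<zeta> i = B" "neighbour \<eta> A = i" "neighbour \<zeta> A = D"
    "neighbour \<eta> B = D" "neighbour \<zeta> B = i" "neighbour \<eta> D = B" "neighbour \<zeta> D = A"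
    by (simp_all add: ABD neighbour_commute[of \<zeta> \<eta>])
  have iA: "opposite u i \<eta> \<longleftrightarrow> u A < 0" and iB: "opposite u i \<zeta> \<longleftrightarrow> u B < 0"
    using i by (simp_all add: opposite_def nb mult_less_0_iff)
  \<comment> \<open>A cut \<eta>-edge has length below 1; the \<zeta>-edge is not longer, so it is
    cut as well.\<close>
  have AB: "u A < 0 \<Longrightarrow> u B < 0"
    using len edge_length_opposite[of u i \<eta>] edge_length_not_opposite[of u i \<zeta>] iA iB by force
  have max: "of_bool (opposite u w \<eta>) + of_bool (opposite u w \<zeta>) \<le> (of_bool (u A < 0) + of_bool (u B < 0) :: nat)" for w
    using origin by (simp add: is_origin_def opp_count iA iB)
  have oppA: "opposite u A \<eta> \<longleftrightarrow> u A < 0" "opposite u A \<zeta> \<longleftrightarrow> u A * u D < 0"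
    and oppB: "opposite u B \<eta> \<longleftrightarrow> u B * u D < 0" "opposite u B \<zeta> \<longleftrightarrow> u B < 0"
    and oppD: "opposite u D \<eta> \<longleftrightarrow> u B * u D < 0" "opposite u D \<zeta> \<longleftrightarrow> u A * u D < 0"
    using i by (auto simp: opposite_def nb mult_less_0_iff)
  have unresolved: "\<not> (u A < 0 \<and> u B < 0 \<and> u D > 0)"
  proof
    assume *: "u A < 0 \<and> u B < 0 \<and> u D > 0"
    have "opposite u w \<gamma>" for w \<gamma>
      using vertices[of w] dir[of \<gamma>] * i oppA oppB oppD iA iB by (auto simp: mult_less_0_iff)
    then show False using resolved by blast
  qed
  have neg: "u A < 0 \<or> u B < 0 \<or> u D < 0"
  proof -
    obtain w where "u w < 0"
      using cut by (auto simp: cut_cell_def)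
    then show ?thesis
      using vertices[of w] i by auto
  qed
  have uB: "u B \<le> 0"
  proof (rule ccontr)
    assume *: "\<not> u B \<le> 0"
    then have "\<not> u A < 0" "\<not> u B < 0"
      using AB by auto
    then have "\<not> u B * u D < 0" "u D < 0"
      using max[of B] neg by (auto simp: oppB)
    then show False
      using * by (simp add: mult_less_0_iff)
  qed
  moreover have "u D \<le> 0"
  proof (rule ccontr)
    assume D: "\<not> u D \<le> 0"
    show False
    proof (cases "u B < 0")
      case True
      then have "u B * u D < 0"
        using D by (simp add: mult_less_0_iff)
      then have "u A < 0"
        using max[of B] True by (cases "u A < 0") (auto simp: oppB)
      then show False
        using unresolved True D by simp
    next
      case False
      then show False
        using AB neg D by auto
    qed
  qed
  moreover have "v = B \<or> v = D"
    using v vertices[of v] ne by (auto simp: ABD neighbour_def)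
  ultimately show ?thesis by blast
qed

lemma uncut_fraction_eq_volume:
  assumes "\<not> cut_cell u"
  shows "uncut_fraction u = phase_volume u"
proof (cases "\<exists>v. u v > 0")
  case True
  then obtain v where "u v > 0" by blast
  moreover have "u w \<ge> 0" for w
    using assms True by (auto simp: cut_cell_def not_less)
  ultimately show ?thesis
    using volume_nonneg[of u v] by (auto simp: uncut_fraction_def)
qed (auto simp: uncut_fraction_def not_less volume_nonpos)

lemma part_fraction_eq_volume:
  fixes u :: "'n::finite set \<Rightarrow> real"
  assumes "part_fraction u a" and card: "CARD('n) = 3"
  shows "a = phase_volume u"
  using assms(1)
proof cases
  case (elementary_part i \<xi> \<eta> \<zeta>)
  then have ne: "\<xi> \<noteq> \<eta>" "\<xi> \<noteq> \<zeta>" "\<eta> \<noteq> \<zeta>" and i: "u i \<noteq> 0"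
    and far: "\<And>v. v \<noteq> i \<Longrightarrow> v \<noteq> neighbour \<xi> i \<Longrightarrow> u v * u i \<le> 0"
    by (auto simp: elementary_config_def is_origin_def)
  note U = three_directions[OF card ne]
  show ?thesis
    unfolding elementary_part(1)
  proof (rule positive_part_eq_volume[of u i, OF i])
    assume "u i > 0"
    then show "cut_volume_3 u i \<xi> \<eta> \<zeta> = phase_volume u"
      using far by (intro cut_volume_3_pos[OF U ne]) (auto simp: mult_le_0_iff)
  next
    assume "u i < 0"
    then show "cut_volume_3 u i \<xi> \<eta> \<zeta> = phase_volume (\<lambda>v. - u v)"
      using far cut_volume_3_pos[OF U ne, of "\<lambda>v. - u v" i]
      by (auto simp: mult_le_0_iff cut_volume_3_uminus)
  qed
qed (simp add: uncut_fraction_eq_volume)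

section \<open>Subdivision and refinement\<close>

lemma has_integral_volume: "((\<lambda>x. of_bool (0 < interp u x)) has_integral phase_volume u) (cbox 0 1)"
proof -
  define P where "P = {x. 0 < interp u x}"
  have P: "P \<in> sets borel"
    unfolding P_def by measurable
  have "((\<lambda>x. 1 :: real) has_integral measure lborel (cbox 0 1 \<inter> P)) (cbox 0 1 \<inter> P)"
    using P emeasure_unit_cbox_le[OF P]
    by (intro has_integral_measure_lborel) (auto simp: less_top[symmetric] top_unique)
  then have "((\<lambda>x. if x \<in> cbox 0 1 \<inter> P then 1 else 0 :: real) has_integral phase_volume u) UNIV"
    unfolding has_integral_restrict_UNIV by (simp add: phase_volume_def P_def)
  moreover have "(\<lambda>x. if x \<in> cbox 0 1 \<inter> P then 1 else 0 :: real) =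
      (\<lambda>x. if x \<in> cbox 0 1 then of_bool (0 < interp u x) else 0)"
    by (auto simp: P_def)
  ultimately show ?thesis
    by (simp only: has_integral_restrict_UNIV)
qed

text \<open>A stretch and a shift carry the unit cube onto the box. A division may contain boxes
  without interior, for which the stretch factors \<open>m\<close> make no sense; there the integral
  and the claimed value are both 0.\<close>

lemma has_integral_volume_box:
  fixes a b :: "real ^ 'n::finite"
  assumes ne: "cbox a b \<noteq> {}"
  shows "((\<lambda>x. of_bool (0 < interp u x)) has_integral
    measure lborel (cbox a b) * phase_volume (part_values u (cbox a b))) (cbox a b)"
proof (cases "measure lborel (cbox a b) = 0")
  case True
  then show ?thesis by (simp add: has_integral_null)
next
  case False
  then have ab: "a $ \<gamma> < b $ \<gamma>" for \<gamma>
  proof -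
    have "a $ \<gamma> \<le> b $ \<gamma>" "b $ \<gamma> - a $ \<gamma> \<noteq> 0"
      using ne False by (simp_all add: content_cbox_cart interval_ne_empty_cart)
    then show ?thesis by simp
  qed
  define g where "g x = (of_bool (0 < interp (part_values u (cbox a b)) x) :: real)" for x
  define m where "m \<gamma> = 1 / (b $ \<gamma> - a $ \<gamma>)" for \<gamma>
  have m: "m \<gamma> > 0" for \<gamma>
    using ab by (simp add: m_def)
  have prod_m: "inverse \<bar>prod m UNIV\<bar> = measure lborel (cbox a b)"
    using m ne by (simp add: content_cbox_cart m_def prod_dividef prod_nonneg abs_of_pos prod_pos ab)
  have "((\<lambda>x. g (\<chi> \<gamma>. m \<gamma> * x $ \<gamma>)) has_integral phase_volume (part_values u (cbox a b)) /\<^sub>R \<bar>prod m UNIV\<bar>)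
      ((\<lambda>x. \<chi> \<gamma>. x $ \<gamma> / m \<gamma>) ` cbox 0 1)"
    unfolding g_def using m
    by (intro has_integral_stretch_cart has_integral_volume) (simp add: less_imp_neq[symmetric])
  also have "(\<lambda>x. \<chi> \<gamma>. x $ \<gamma> / m \<gamma>) ` cbox 0 1 = cbox 0 (b - a)"
  proof (intro equalityI subsetI)
    fix x assume "x \<in> cbox 0 (b - a)"
    then have "x = (\<chi> \<gamma>. (\<chi> \<gamma>. m \<gamma> * x $ \<gamma>) $ \<gamma> / m \<gamma>)" "(\<chi> \<gamma>. m \<gamma> * x $ \<gamma>) \<in> cbox 0 1"
      using m ab by (auto simp: vec_eq_iff mem_box_cart m_def less_imp_neq[symmetric] field_simps)
    then show "x \<in> (\<lambda>x. \<chi> \<gamma>. x $ \<gamma> / m \<gamma>) ` cbox 0 1"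
      by blast
  qed (use ab in \<open>auto simp: mem_box_cart m_def less_imp_le mult_left_le_one_le\<close>)
  finally have "((\<lambda>x. g (\<chi> \<gamma>. m \<gamma> * (x + - a) $ \<gamma>)) has_integral
      phase_volume (part_values u (cbox a b)) /\<^sub>R \<bar>prod m UNIV\<bar>) (cbox (0 - - a) (b - a - - a))"
    by (rule has_integral_shift_cbox)
  moreover have "g (\<chi> \<gamma>. m \<gamma> * (x + - a) $ \<gamma>) = of_bool (0 < interp u x)" for x
  proof -
    have "(\<chi> \<gamma>. a $ \<gamma> + (b $ \<gamma> - a $ \<gamma>) * (\<chi> \<gamma>. m \<gamma> * (x + - a) $ \<gamma>) $ \<gamma>) = x"
      using ab by (auto simp: vec_eq_iff m_def less_imp_neq[symmetric])
    then show ?thesis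
      by (simp only: g_def interp_box[OF ne])
  qed
  ultimately show ?thesis
    by (simp add: divideR_right[symmetric] prod_m scaleR_conv_of_real)
qed

lemma volume_division:
  assumes D: "D division_of cbox 0 1"
  shows "phase_volume u = (\<Sum>K\<in>D. measure lborel K * phase_volume (part_values u K))"
proof (rule has_integral_unique[OF has_integral_volume has_integral_combine_division[OF D]])
  fix K assume "K \<in> D"
  then obtain a b where "K = cbox a b" "K \<noteq> {}"
    using D by (metis division_ofD(3,4))
  then show "((\<lambda>x. of_bool (0 < interp u x)) has_integral measure lborel K * phase_volume (part_values u K)) K"
    using has_integral_volume_box by blast
qed

text \<open>Whichever origin, directions and splitting are chosen, the result is the exact volume,
  so ties do not affect it.\<close>

lemma volume_fraction_eq_volume:
  fixes u :: "'n::finite set \<Rightarrow> real"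
  assumes "volume_fraction u a" and resolved: "cut_cell u \<Longrightarrow> resolved u"
  shows "a = phase_volume u"
  using assms(1)
proof cases
  case uncut
  then show ?thesis by (simp add: uncut_fraction_eq_volume)
next
  case (cut_2 i \<eta> \<zeta>)
  then have i: "u i \<noteq> 0" and res: "\<not> (\<forall>v \<gamma>. opposite u v \<gamma>)"
    using resolved by (auto simp: is_origin_def resolved_def)
  note U = two_directions[OF cut_2(2) cut_2(5)]
  show ?thesis
    unfolding cut_2(1)
  proof (rule positive_part_eq_volume[of u i, OF i])
    assume "u i > 0"
    then show "cut_volume_2 u i \<eta> \<zeta> = phase_volume u"
      using cut_2 res by (intro cut_volume_2_pos[OF U]) (auto intro: resolved_far_side)
  next
    assume "u i < 0"
    moreover from this have "- u v \<le> 0" if "\<zeta> \<in> v \<longleftrightarrow> \<zeta> \<notin> i" for v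
      using cut_2 res that
      by (intro resolved_far_side[of \<eta> \<zeta> "\<lambda>v. - u v" i])
         (simp_all add: cut_cell_uminus is_origin_uminus edge_length_uminus opposite_uminus)
    ultimately show "cut_volume_2 u i \<eta> \<zeta> = phase_volume (\<lambda>v. - u v)"
      using cut_volume_2_pos[OF U cut_2(5), of "\<lambda>v. - u v" i]
      by (simp add: cut_volume_2_uminus)
  qed
next
  case (cut_3 D w)
  then have "w K = phase_volume (part_values u K)" if "K \<in> D" for K
    using that part_fraction_eq_volume by blast
  then show ?thesis
    using cut_3 volume_division[of D u] by (simp add: splitting_def)
qed

section \<open>Dyadic mesh cells as a division of the domain\<close>

lemma mem_cell_box:
  fixes h :: "real ^ 'n::finite"
  assumes h: "\<And>\<gamma>. h $ \<gamma> > 0"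
  shows "x \<in> cell_box x0 h k c \<longleftrightarrow> (\<forall>\<gamma>. of_int (c $ \<gamma>) \<le> 2 ^ k * ((x $ \<gamma> - x0 $ \<gamma>) / h $ \<gamma>) \<and>
    2 ^ k * ((x $ \<gamma> - x0 $ \<gamma>) / h $ \<gamma>) \<le> of_int (c $ \<gamma> + 1))"
proof -
  have "x0 $ \<gamma> + h $ \<gamma> * r / 2 ^ k \<le> x $ \<gamma> \<longleftrightarrow> r \<le> 2 ^ k * ((x $ \<gamma> - x0 $ \<gamma>) / h $ \<gamma>)"
    "x $ \<gamma> \<le> x0 $ \<gamma> + h $ \<gamma> * r / 2 ^ k \<longleftrightarrow> 2 ^ k * ((x $ \<gamma> - x0 $ \<gamma>) / h $ \<gamma>) \<le> r" for \<gamma> r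
    using h[of \<gamma>] by (simp_all add: field_simps)
  then show ?thesis
    by (simp only: cell_box_def mem_box_cart vec_lambda_beta)
qed

lemma cell_box_nonempty:
  fixes h :: "real ^ 'n::finite"
  assumes "\<And>\<gamma>. h $ \<gamma> > 0"
  shows "cell_box x0 h k c \<noteq> {}"
  unfolding cell_box_def interval_ne_empty_cart
  using assms by (auto simp: divide_le_cancel less_imp_le)

lemma measure_cell_box:
  fixes h :: "real ^ 'n::finite"
  assumes h: "\<And>\<gamma>. h $ \<gamma> > 0"
  shows "measure lborel (cell_box x0 h k c) = (\<Prod>\<gamma>\<in>UNIV. h $ \<gamma>) / 2 ^ (k * CARD('n))"
proof -
  have "measure lborel (cell_box x0 h k c) = (\<Prod>\<gamma>\<in>UNIV. h $ \<gamma> / 2 ^ k)"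
    using cell_box_nonempty[OF h, of x0 k c] unfolding cell_box_def
    by (subst content_cbox_cart) (auto intro!: prod.cong simp: field_simps)
  then show ?thesis
    by (simp add: prod_dividef power_mult)
qed

lemma interior_cell_box_disjoint:
  fixes h :: "real ^ 'n::finite"
  assumes h: "\<And>\<gamma>. h $ \<gamma> > 0" and "c \<noteq> c'"
  shows "interior (cell_box x0 h k c) \<inter> interior (cell_box x0 h k c') = {}"
proof -
  have disj: "interior (cell_box x0 h k c) \<inter> interior (cell_box x0 h k c') = {}"
    if "c $ \<gamma> + 1 \<le> c' $ \<gamma>" for c c' and \<gamma> :: 'n
  proof -
    have "real_of_int (c $ \<gamma> + 1) \<le> real_of_int (c' $ \<gamma>)"
      using that by (simp only: of_int_le_iff)
    then have le: "h $ \<gamma> * real_of_int (c $ \<gamma> + 1) / 2 ^ k \<le> h $ \<gamma> * real_of_int (c' $ \<gamma>) / 2 ^ k"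
      using h[of \<gamma>] by (intro divide_right_mono mult_left_mono) (auto simp: less_imp_le)
    show ?thesis
    proof (rule equals0I)
      fix x assume "x \<in> interior (cell_box x0 h k c) \<inter> interior (cell_box x0 h k c')"
      then have "x $ \<gamma> < x0 $ \<gamma> + h $ \<gamma> * real_of_int (c $ \<gamma> + 1) / 2 ^ k"
        "x0 $ \<gamma> + h $ \<gamma> * real_of_int (c' $ \<gamma>) / 2 ^ k < x $ \<gamma>"
        unfolding cell_box_def interior_cbox Int_iff mem_box_cart vec_lambda_beta by blast+
      then show False
        using le by linarith
    qed
  qed
  obtain \<gamma> where "c $ \<gamma> \<noteq> c' $ \<gamma>"
    using \<open>c \<noteq> c'\<close> by (auto simp: vec_eq_iff)
  then have "c $ \<gamma> + 1 \<le> c' $ \<gamma> \<or> c' $ \<gamma> + 1 \<le> c $ \<gamma>"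
    by linarith
  then show ?thesis
    using disj by blast
qed

definition child :: "int ^ 'n \<Rightarrow> 'n set \<Rightarrow> int ^ 'n" where
  "child c s = (\<chi> \<gamma>. 2 * c $ \<gamma> + of_bool (\<gamma> \<in> s))"

lemma child_nth [simp]: "child c s $ \<gamma> = 2 * c $ \<gamma> + of_bool (\<gamma> \<in> s)"
  by (simp add: child_def)

text \<open>The pattern \<open>s\<close> is recovered from the parities of the child index, and
  \<open>c\<close> by halving.\<close>

lemma inj_child: "inj_on (\<lambda>(c, s). child c s) A"
proof (rule inj_onI, clarify)
  fix c c' :: "int ^ 'a" and s s'
  assume "child c s = child c' s'"
  then have *: "2 * c $ \<gamma> + of_bool (\<gamma> \<in> s) = 2 * c' $ \<gamma> + of_bool (\<gamma> \<in> s')" for \<gamma>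
    by (metis child_nth)
  have "c $ \<gamma> = c' $ \<gamma> \<and> (\<gamma> \<in> s \<longleftrightarrow> \<gamma> \<in> s')" for \<gamma>
    using *[of \<gamma>] by (cases "\<gamma> \<in> s"; cases "\<gamma> \<in> s'"; simp; presburger)
  then show "c = c' \<and> s = s'"
    by (auto simp: vec_eq_iff)
qed

lemma mesh_Suc: "mesh C (Suc k) = (\<lambda>(c, s). child c s) ` (mesh C k \<times> UNIV)"
  by (auto simp: child_def)

lemma finite_mesh:
  fixes C :: "(int ^ 'n::finite) set"
  shows "finite C \<Longrightarrow> finite (mesh C k)"
  by (induction k) (simp_all add: mesh_Suc del: mesh.simps(2))

lemma cell_box_children:
  fixes h :: "real ^ 'n::finite"
  assumes h: "\<And>\<gamma>. h $ \<gamma> > 0"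
  shows "cell_box x0 h k c = (\<Union>s. cell_box x0 h (Suc k) (child c s))"
proof (intro equalityI subsetI)
  fix x
  \<comment> \<open>In these rescaled coordinates a level-\<open>k\<close> cell is bounded by
    consecutive integers, and passing to the next level doubles \<open>y\<close>.\<close>
  define y where "y \<gamma> = 2 ^ k * ((x $ \<gamma> - x0 $ \<gamma>) / h $ \<gamma>)" for \<gamma>
  have mem: "x \<in> cell_box x0 h k c \<longleftrightarrow>
      (\<forall>\<gamma>. of_int (c $ \<gamma>) \<le> y \<gamma> \<and> y \<gamma> \<le> of_int (c $ \<gamma> + 1))"
    "x \<in> cell_box x0 h (Suc k) (child c s) \<longleftrightarrow>
      (\<forall>\<gamma>. of_int (child c s $ \<gamma>) \<le> 2 * y \<gamma> \<and> 2 * y \<gamma> \<le> of_int (child c s $ \<gamma> + 1))" for c s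
    by (simp_all only: mem_cell_box[OF h] y_def power_Suc mult.assoc)
  show "x \<in> (\<Union>s. cell_box x0 h (Suc k) (child c s))" if "x \<in> cell_box x0 h k c"
  proof
    \<comment> \<open>The chosen child takes the upper half in exactly those directions in which
      \<open>x\<close> lies at or above the midpoint.\<close>
    show "x \<in> cell_box x0 h (Suc k) (child c {\<gamma>. of_int (2 * c $ \<gamma> + 1) \<le> 2 * y \<gamma>})"
      unfolding mem(2)
    proof
      fix \<gamma>
      show "of_int (child c {\<gamma>. of_int (2 * c $ \<gamma> + 1) \<le> 2 * y \<gamma>} $ \<gamma>) \<le> 2 * y \<gamma> \<and>
          2 * y \<gamma> \<le> of_int (child c {\<gamma>. of_int (2 * c $ \<gamma> + 1) \<le> 2 * y \<gamma>} $ \<gamma> + 1)"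
        using that[unfolded mem(1), rule_format, of \<gamma>] by auto
    qed
  qed simp
  show "x \<in> cell_box x0 h k c" if x: "x \<in> (\<Union>s. cell_box x0 h (Suc k) (child c s))"
  proof -
    obtain s where s: "x \<in> cell_box x0 h (Suc k) (child c s)"
      using x by blast
    have "of_int (c $ \<gamma>) \<le> y \<gamma> \<and> y \<gamma> \<le> of_int (c $ \<gamma> + 1)" for \<gamma>
      using s[unfolded mem(2), rule_format, of \<gamma>] by (cases "\<gamma> \<in> s") auto
    then show ?thesis
      unfolding mem by blast
  qed
qed

lemma mesh_division:
  fixes h :: "real ^ 'n::finite"
  assumes h: "\<And>\<gamma>. h $ \<gamma> > 0" and C: "finite C"
  shows "(cell_box x0 h k ` mesh C k) division_of mesh_domain x0 h C"
proof (rule division_ofI)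
  show "\<Union> (cell_box x0 h k ` mesh C k) = mesh_domain x0 h C"
  proof (induction k)
    case (Suc k)
    have "(\<Union>c\<in>mesh C (Suc k). cell_box x0 h (Suc k) c) = (\<Union>c\<in>mesh C k. cell_box x0 h k c)"
      unfolding mesh_Suc cell_box_children[OF h, of x0 k] by auto
    then show ?case using Suc by simp
  qed (simp add: mesh_domain_def)
  show "K \<subseteq> mesh_domain x0 h C" if "K \<in> cell_box x0 h k ` mesh C k" for K
    using \<open>\<Union> (cell_box x0 h k ` mesh C k) = mesh_domain x0 h C\<close> that by blast
  show "K \<noteq> {}" "\<exists>a b. K = cbox a b" if "K \<in> cell_box x0 h k ` mesh C k" for K
    using that cell_box_nonempty[OF h] by (auto simp: cell_box_def)
  show "interior K \<inter> interior K' = {}"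
    if K: "K \<in> cell_box x0 h k ` mesh C k" "K' \<in> cell_box x0 h k ` mesh C k" "K \<noteq> K'" for K K'
  proof -
    obtain c c' where "K = cell_box x0 h k c" "K' = cell_box x0 h k c'" "c \<noteq> c'"
      using K by blast
    then show ?thesis
      using interior_cell_box_disjoint[OF h] by simp
  qed
qed (simp add: finite_mesh[OF C])

text \<open>Allows sums over boxes to be rewritten as sums over indices. Two indices with the same
  box would give it empty interior, contradicting its positive measure.\<close>

lemma inj_cell_box:
  fixes h :: "real ^ 'n::finite"
  assumes h: "\<And>\<gamma>. h $ \<gamma> > 0"
  shows "inj (cell_box x0 h k)"
proof (rule injI, rule ccontr)
  fix c c' assume *: "cell_box x0 h k c = cell_box x0 h k c'" "c \<noteq> c'"
  have "interior (cell_box x0 h k c) = {}"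
    using interior_cell_box_disjoint[OF h *(2), of x0 k] *(1) by simp
  then have "measure lborel (cell_box x0 h k c) = 0"
    by (simp add: cell_box_def content_eq_0_interior)
  then show False
    using h by (simp add: measure_cell_box prod_zero_iff less_imp_neq[symmetric])
qed

section \<open>Exact volumes under refinement and integration of the field\<close>

lemma volume_children:
  fixes u :: "'n::finite set \<Rightarrow> real"
  shows "phase_volume u = (\<Sum>s\<in>UNIV. phase_volume (\<lambda>v. interp u (\<chi> \<gamma>. (of_bool (\<gamma> \<in> s) + of_bool (\<gamma> \<in> v)) / 2))) / 2 ^ CARD('n)"
proof -
  \<comment> \<open>The unit cube is viewed as a mesh with the single cell 0, corner 0 and widths 1;
    its first refinement supplies the division into \<open>2 ^ CARD('n)\<close> subcubes.\<close>
  define box :: "'n set \<Rightarrow> (real ^ 'n) set" where "box s = cell_box 0 1 1 (child 0 s)" for s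
  have h: "(1 :: real ^ 'n) $ \<gamma> > 0" for \<gamma>
    by simp
  have "mesh {0 :: int ^ 'n} 1 = range (child 0)"
    using mesh_Suc[of "{0 :: int ^ 'n}" 0] by (auto simp: image_iff)
  then have range: "range box = cell_box 0 1 1 ` mesh {0} 1"
    by (auto simp: box_def)
  have "cell_box 0 1 0 (0 :: int ^ 'n) = cbox 0 1"
    by (simp add: cell_box_def zero_vec_def one_vec_def)
  then have div: "range box division_of cbox 0 1"
    using mesh_division[OF h, of "{0}" 0 1] by (simp add: range mesh_domain_def)
  have "inj (child (0 :: int ^ 'n))"
    using inj_child[of UNIV] by (auto simp: inj_on_def)
  then have inj: "inj box"
    using inj_cell_box[OF h, of 0 1] by (simp add: box_def inj_def)
  have part: "part_values u (box s) = (\<lambda>v. interp u (\<chi> \<gamma>. (of_bool (\<gamma> \<in> s) + of_bool (\<gamma> \<in> v)) / 2))" for s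
  proof
    fix v
    define a b :: "real ^ 'n" where "a = (\<chi> \<gamma>. of_bool (\<gamma> \<in> s) / 2)" and "b = (\<chi> \<gamma>. (of_bool (\<gamma> \<in> s) + 1) / 2)"
    have "box s = cbox a b"
      by (simp add: box_def cell_box_def a_def b_def)
    moreover have "cbox a b \<noteq> {}"
      by (simp add: interval_ne_empty_cart a_def b_def)
    moreover from this have "interval_lowerbound (cbox a b) = a" "interval_upperbound (cbox a b) = b"
      by simp_all
    ultimately have "part_values u (box s) v = interp u (\<chi> \<gamma>. if \<gamma> \<in> v then b $ \<gamma> else a $ \<gamma>)"
      by (simp only: part_values_def)
    also have "(\<chi> \<gamma>. if \<gamma> \<in> v then b $ \<gamma> else a $ \<gamma>) = (\<chi> \<gamma>. (of_bool (\<gamma> \<in> s) + of_bool (\<gamma> \<in> v)) / 2)"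
      by (simp add: vec_eq_iff a_def b_def)
    finally show "part_values u (box s) v = interp u (\<chi> \<gamma>. (of_bool (\<gamma> \<in> s) + of_bool (\<gamma> \<in> v)) / 2)" .
  qed
  have "measure lborel (box s) = 1 / 2 ^ CARD('n)" for s
    unfolding box_def by (subst measure_cell_box[OF h]) simp
  then have "phase_volume u = (\<Sum>s\<in>UNIV. 1 / 2 ^ CARD('n) * phase_volume (part_values u (box s)))"
    by (subst volume_division[OF div], subst sum.reindex[OF inj]) simp
  then show ?thesis
    by (simp add: part sum_divide_distrib)
qed

text \<open>Inside the parent, vertex \<open>v\<close> of child \<open>s\<close> has offset
  \<open>s + v\<close> in the refined grid, with entries 0, 1 or 2, hence half of that as local
  coordinates.\<close>

lemma cell_values_child:
  assumes "interpolation_refinement C k \<phi> \<phi>'" "c \<in> mesh C k"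
  shows "cell_values \<phi>' (child c s) v =
    interp (cell_values \<phi> c) (\<chi> \<gamma>. (of_bool (\<gamma> \<in> s) + of_bool (\<gamma> \<in> v)) / 2)"
proof -
  define t :: "int ^ 'a" where "t = (\<chi> \<gamma>. of_bool (\<gamma> \<in> s) + of_bool (\<gamma> \<in> v))"
  have "\<forall>\<gamma>. t $ \<gamma> \<in> {0, 1, 2}"
    by (auto simp: t_def)
  then have "\<phi>' (\<chi> \<gamma>. 2 * c $ \<gamma> + t $ \<gamma>) = interp (cell_values \<phi> c) (\<chi> \<gamma>. of_int (t $ \<gamma>) / 2)"
    using assms unfolding interpolation_refinement_def by blast
  moreover have "(\<chi> \<gamma>. 2 * c $ \<gamma> + t $ \<gamma>) = (\<chi> \<gamma>. child c s $ \<gamma> + of_bool (\<gamma> \<in> v))"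
    by (simp add: vec_eq_iff t_def)
  moreover have "(\<chi> \<gamma>. of_int (t $ \<gamma>) / 2) = (\<chi> \<gamma>. (of_bool (\<gamma> \<in> s) + of_bool (\<gamma> \<in> v)) / (2 :: real))"
    by (simp add: vec_eq_iff t_def)
  ultimately show ?thesis
    by (simp only: cell_values_def)
qed

text \<open>Stated for exact volumes, so that the induction passes through the levels in between
  without computed fractions there. The divisor accounts for the size of a level-\<open>k\<close>
  cell relative to level 0.\<close>

lemma sum_volume_refinement:
  fixes \<phi> :: "nat \<Rightarrow> int ^ 'n::finite \<Rightarrow> real"
  assumes ref: "\<And>k. interpolation_refinement C k (\<phi> k) (\<phi> (Suc k))"
  shows "(\<Sum>c\<in>mesh C k. phase_volume (cell_values (\<phi> k) c)) / 2 ^ (k * CARD('n)) =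
    (\<Sum>c\<in>C. phase_volume (cell_values (\<phi> 0) c))"
proof (induction k)
  case (Suc k)
  have "(\<Sum>c\<in>mesh C (Suc k). phase_volume (cell_values (\<phi> (Suc k)) c)) =
      (\<Sum>(c, s)\<in>mesh C k \<times> UNIV. phase_volume (cell_values (\<phi> (Suc k)) (child c s)))"
    unfolding mesh_Suc by (subst sum.reindex[OF inj_child]) (simp add: case_prod_beta)
  also have "\<dots> = (\<Sum>c\<in>mesh C k. \<Sum>s\<in>UNIV. phase_volume (cell_values (\<phi> (Suc k)) (child c s)))"
    by (rule sum.cartesian_product[symmetric])
  also have "\<dots> = (\<Sum>c\<in>mesh C k. 2 ^ CARD('n) * phase_volume (cell_values (\<phi> k) c))"
  proof (rule sum.cong[OF refl])
    fix c assume c: "c \<in> mesh C k"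
    have "cell_values (\<phi> (Suc k)) (child c s) =
        (\<lambda>v. interp (cell_values (\<phi> k) c) (\<chi> \<gamma>. (of_bool (\<gamma> \<in> s) + of_bool (\<gamma> \<in> v)) / 2))" for s
      using cell_values_child[OF ref c] by blast
    then show "(\<Sum>s\<in>UNIV. phase_volume (cell_values (\<phi> (Suc k)) (child c s))) =
        2 ^ CARD('n) * phase_volume (cell_values (\<phi> k) c)"
      by (simp add: volume_children[of "cell_values (\<phi> k) c"])
  qed
  finally show ?case
    using Suc by (simp add: sum_distrib_left[symmetric] power_add)
qed simp

lemma has_integral_volume_fraction_field:
  fixes h :: "real ^ 'n::finite"
  assumes h: "\<And>\<gamma>. h $ \<gamma> > 0" and C: "finite C"
    and field: "volume_fraction_field x0 h C k \<phi> A"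
    and resolved: "\<And>c. c \<in> mesh C k \<Longrightarrow> cut_cell (cell_values \<phi> c) \<Longrightarrow> resolved (cell_values \<phi> c)"
  shows "(A has_integral (\<Prod>\<gamma>\<in>UNIV. h $ \<gamma>) *
    ((\<Sum>c\<in>mesh C k. phase_volume (cell_values \<phi> c)) / 2 ^ (k * CARD('n)))) (mesh_domain x0 h C)"
proof -
  \<comment> \<open>Summation over a division needs a function of the box; the inverse recovers the
    cell index from it.\<close>
  define V where "V K = measure lborel K * phase_volume (cell_values \<phi> (the_inv (cell_box x0 h k) K))" for K
  have inv: "the_inv (cell_box x0 h k) (cell_box x0 h k c) = c" for c
    by (rule the_inv_f_f[OF inj_cell_box[OF h]])
  have "(A has_integral sum V (cell_box x0 h k ` mesh C k)) (mesh_domain x0 h C)"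
  proof (rule has_integral_combine_division[OF mesh_division[OF h C]])
    fix K assume "K \<in> cell_box x0 h k ` mesh C k"
    then obtain c where c: "c \<in> mesh C k" and K: "K = cell_box x0 h k c"
      by blast
    have A: "A x = phase_volume (cell_values \<phi> c)" if "x \<in> interior K" for x
      using field c that volume_fraction_eq_volume[OF _ resolved[OF c]]
      unfolding volume_fraction_field_def K by metis
    have "V K = measure lborel K * phase_volume (cell_values \<phi> c)"
      by (simp add: V_def K inv)
    \<comment> \<open>The field is prescribed on the interior of the box only; the boundary is
      null.\<close>
    moreover have "(A has_integral measure lborel K *\<^sub>R phase_volume (cell_values \<phi> c)) K"
      using A unfolding K cell_box_def interior_cbox
      by (rule has_integral_spike_interior[OF has_integral_const])
    ultimately show "(A has_integral V K) K"
      by simp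
  qed
  also have "sum V (cell_box x0 h k ` mesh C k) =
      (\<Sum>c\<in>mesh C k. (\<Prod>\<gamma>\<in>UNIV. h $ \<gamma>) / 2 ^ (k * CARD('n)) * phase_volume (cell_values \<phi> c))"
    by (subst sum.reindex[OF inj_on_subset[OF inj_cell_box[OF h]]])
       (simp_all add: V_def inv measure_cell_box[OF h])
  finally show ?thesis
    by (simp add: sum_distrib_left sum_divide_distrib)
qed

theorem mainTheorem1:
  fixes x0 h :: "real ^ 'n::finite"
    and C :: "(int ^ 'n) set"
    and \<phi> :: "nat \<Rightarrow> int ^ 'n \<Rightarrow> real"
    and \<alpha> :: "nat \<Rightarrow> real ^ 'n \<Rightarrow> real"
    and l :: nat
  assumes dim: "CARD('n) \<in> {2, 3}"
    and mesh: "finite C" "\<And>\<gamma>. h $ \<gamma> > 0"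
    and refinement: "\<And>k. interpolation_refinement C k (\<phi> k) (\<phi> (Suc k))"
    and resolved: "\<And>k c. k \<in> {0, l} \<Longrightarrow> c \<in> mesh C k \<Longrightarrow> cut_cell (cell_values (\<phi> k) c) \<Longrightarrow>
      resolved (cell_values (\<phi> k) c)"
    and fraction: "\<And>k. k \<in> {0, l} \<Longrightarrow> volume_fraction_field x0 h C k (\<phi> k) (\<alpha> k)"
  shows "integral (mesh_domain x0 h C) (\<alpha> 0) = integral (mesh_domain x0 h C) (\<alpha> l)"
proof -
  \<comment> \<open>The value refers to level 0 for either \<open>k\<close>, and
    \<open>has_integral\<close> ensures that neither integral is a default value.\<close>
  have "(\<alpha> k has_integral (\<Prod>\<gamma>\<in>UNIV. h $ \<gamma>) * (\<Sum>c\<in>C. phase_volume (cell_values (\<phi> 0) c)))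
      (mesh_domain x0 h C)" if k: "k \<in> {0, l}" for k
    using has_integral_volume_fraction_field[OF mesh(2,1) fraction[OF k] resolved[OF k]]
    unfolding sum_volume_refinement[of C \<phi> k, OF refinement] .
  then have "integral (mesh_domain x0 h C) (\<alpha> k) =
      (\<Prod>\<gamma>\<in>UNIV. h $ \<gamma>) * (\<Sum>c\<in>C. phase_volume (cell_values (\<phi> 0) c))" if "k \<in> {0, l}" for k
    using that by (intro integral_unique)
  then show ?thesis by simp
qed

end
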